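(* Let $t_0=\max\{512e^2B^2\log N,1\}$. The algorithm ${\sf CP}(\phi_{\mathrm{NH}},[0,\infty))$ with initial time $t_0$, where $\phi_{\mathrm{NH}}(y,t)=t^{-1/2}\exp(y^2/(2t))$, run on the experts game with $N$ experts and loss range bound $B>0$, returns $V_T$ such that for all $\epsilon\in(0,1)$ and all $T\ge1$, $$\mathrm{Regret}_\epsilon(T)\le\sqrt{(t_0+2V_T)\big(\log(t_0+2V_T)+2\log(1/\epsilon)\big)}.$$
   Context: Experts game: $N\ge1$ experts and a constant $B>0$. In each round $j=1,2,\dots$ the player chooses $\boldsymbol p_j$ in the probability simplex $\Delta^{N-1}$, then nature reveals $\boldsymbol\ell_j\in\mathbb{R}^N$ with $\max_{i,i'}|\ell_{j,i}-\ell_{j,i'}|\le B$. The instantaneous regret is $\Delta x_{j,i}=\langle \boldsymbol p_j,\boldsymbol\ell_j\rangle-\ell_{j,i}$ and the regret vector is $\boldsymbol x_j=\sum_{k\le j}\Delta\boldsymbol x_k$ ($\boldsymbol x_0=\boldsymbol 0$). For $\epsilon\in(0,1]$, $\mathrm{Regret}_\epsilon(T)=x_{T,(\lfloor N\epsilon\rfloor)}$, the $\lfloor N\epsilon\rfloor$-th largest coordinate of $\boldsymbol x_T$. For a potential $\phi(y,t)$ and domain $\mathcal D\subseteq\mathbb{R}$ (an interval) with Euclidean projection $\Pi_{\mathcal D}$ applied coordinatewise, let $\Phi(\boldsymbol x,t)=\sum_{i=1}^N\phi(x_i,t)$. Algorithm ${\sf CP}(\phi,\mathcal D)$ with initial time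 $t_0$: set $\boldsymbol x_0=\boldsymbol0$, $\tilde{\boldsymbol x}_0=\Pi_{\mathcal D}(\boldsymbol x_0)$, $V_0=0$. For $j=1,\dots,T$: play $p_{j,i}\propto\partial_x\phi(\tilde x_{j-1,i},t_{j-1})$ (arbitrary $\boldsymbol p_j$ if all these are zero); observe $\boldsymbol\ell_j$; set $\boldsymbol x_j=\boldsymbol x_{j-1}+\Delta\boldsymbol x_j$, $\tilde{\boldsymbol x}_j=\Pi_{\mathcal D}(\boldsymbol x_j)$; find $\Delta t_j\ge0$ with $\Phi(\tilde{\boldsymbol x}_j,t_{j-1}+\Delta t_j)=\Phi(\tilde{\boldsymbol x}_{j-1},t_{j-1})$ and set $t_j=t_{j-1}+\Delta t_j$; set $V_j=V_{j-1}+\mathbb{E}_{i\sim\boldsymbol q_j}[\Delta x_{j,i}^2]$ where $q_{j,i}\propto\partial_{xx}\phi(\tilde x_{j-1,i},t_{j-1})$. Return $V_T$. *)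

theory Defs
  imports "HOL-Analysis.Analysis"
begin

text \<open>Vectors in R^N are functions nat => real; only indices i < N matter.
  Rounds are indexed by j = 1, 2, ...; index 0 is the initial state.
  Loss vectors: l j i (round j, expert i).\<close>

definition proj :: "real set \<Rightarrow> real \<Rightarrow> real" where
  "proj D y = (THE z. z \<in> D \<and> (\<forall>w\<in>D. \<bar>y - z\<bar> \<le> \<bar>y - w\<bar>))"

definition dphi :: "(real \<Rightarrow> real \<Rightarrow> real) \<Rightarrow> real \<Rightarrow> real \<Rightarrow> real" where
  "dphi phi y t = deriv (\<lambda>z. phi z t) y"

definition ddphi :: "(real \<Rightarrow> real \<Rightarrow> real) \<Rightarrow> real \<Rightarrow> real \<Rightarrow> real" where
  "ddphi phi y t = deriv (\<lambda>z. deriv (\<lambda>w. phi w t) z) y"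

definition Phi :: "(real \<Rightarrow> real \<Rightarrow> real) \<Rightarrow> nat \<Rightarrow> (nat \<Rightarrow> real) \<Rightarrow> real \<Rightarrow> real" where
  "Phi phi N x t = (\<Sum>i<N. phi (x i) t)"

definition prob_simplex :: "nat \<Rightarrow> (nat \<Rightarrow> real) \<Rightarrow> bool" where
  "prob_simplex N p \<longleftrightarrow> (\<forall>i<N. 0 \<le> p i) \<and> (\<Sum>i<N. p i) = 1"

definition inst_regret :: "nat \<Rightarrow> (nat \<Rightarrow> real) \<Rightarrow> (nat \<Rightarrow> real) \<Rightarrow> nat \<Rightarrow> real" where
  "inst_regret N p l i = (\<Sum>k<N. p k * l k) - l i"

text \<open>A (valid) run of CP(phi, D) with initial time t0 on the loss sequence l:
  p j = played distribution in round j, x j = regret vector after round j,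
  t j = time after round j, V j = accumulated variance after round j.
  The projected regret vector is proj D (x j i).  All nondeterministic choices of
  the algorithm (arbitrary p_j when all derivatives vanish, choice of Delta t_j)
  are allowed.\<close>
definition cp_run ::
  "(real \<Rightarrow> real \<Rightarrow> real) \<Rightarrow> real set \<Rightarrow> nat \<Rightarrow> real \<Rightarrow> (nat \<Rightarrow> nat \<Rightarrow> real)
   \<Rightarrow> (nat \<Rightarrow> nat \<Rightarrow> real) \<Rightarrow> (nat \<Rightarrow> nat \<Rightarrow> real) \<Rightarrow> (nat \<Rightarrow> real) \<Rightarrow> (nat \<Rightarrow> real) \<Rightarrow> bool"
  where
  "cp_run phi D N t0 l p x t V \<longleftrightarrow>
     (\<forall>i<N. x 0 i = 0) \<and> t 0 = t0 \<and> V 0 = 0 \<and>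
     (\<forall>j\<ge>1.
        prob_simplex N (p j) \<and>
        ((\<exists>i<N. dphi phi (proj D (x (j-1) i)) (t (j-1)) \<noteq> 0) \<longrightarrow>
           (\<exists>c>0. \<forall>i<N. p j i = c * dphi phi (proj D (x (j-1) i)) (t (j-1)))) \<and>
        (\<forall>i<N. x j i = x (j-1) i + inst_regret N (p j) (l j) i) \<and>
        t (j-1) \<le> t j \<and>
        Phi phi N (\<lambda>i. proj D (x j i)) (t j) = Phi phi N (\<lambda>i. proj D (x (j-1) i)) (t (j-1)) \<and>
        V j = V (j-1) +
          (\<Sum>i<N. (ddphi phi (proj D (x (j-1) i)) (t (j-1))
                     / (\<Sum>k<N. ddphi phi (proj D (x (j-1) k)) (t (j-1))))
                   * (inst_regret N (p j) (l j) i)\<^sup>2))"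

definition phi_NH :: "real \<Rightarrow> real \<Rightarrow> real" where
  "phi_NH y t = t powr (-1/2) * exp (y\<^sup>2 / (2 * t))"

definition kth_largest :: "nat \<Rightarrow> nat \<Rightarrow> (nat \<Rightarrow> real) \<Rightarrow> real" where
  "kth_largest N k x = rev (sort (map x [0..<N])) ! (k - 1)"

text \<open>Regret_eps = floor(N eps)-th largest coordinate; for floor(N eps) = 0 (undefined in
  the paper) we use the convention of the largest coordinate (k = 1).\<close>
definition regret_eps :: "nat \<Rightarrow> real \<Rightarrow> (nat \<Rightarrow> real) \<Rightarrow> real" where
  "regret_eps N eps x = kth_largest N (max 1 (nat \<lfloor>real N * eps\<rfloor>)) x"

end

theory Submission
  imports Defs
begin

text \<open>
  The potential solves the backward heat equation \<open>\<partial>\<^sub>t \<phi> = - \<partial>\<^sub>x\<^sub>x \<phi> / 2\<close>, and the played weights annihilate the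
  first-order change of \<open>\<Phi>\<close>. Keeping \<open>\<Phi>\<close> constant therefore costs, to second order, exactly the
  time \<open>\<Delta>t = \<Delta>V\<close>; the choice of \<open>t\<^sub>0\<close> makes the regret increments so small that the higher-order
  terms give \<open>\<Delta>t \<le> 21/20 * \<Delta>V\<close>. Since \<open>\<Phi>\<close> stays at \<open>N / sqrt t\<^sub>0\<close>, at least \<open>k\<close> coordinates above
  \<open>X > 0\<close> force \<open>k * exp (X\<^sup>2 / (2 * t)) + (N - k) \<le> N * sqrt (t / t\<^sub>0)\<close>.

  Rounding \<open>k = \<lfloor>N * \<epsilon>\<rfloor>\<close> may lose up to a factor \<open>2\<close> in \<open>N / k\<close> against \<open>1 / \<epsilon>\<close>. When \<open>t\<^sub>0\<close> is close to \<open>1\<close> this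
  is paid for by the gap between \<open>t\<close> and \<open>t\<^sub>0 + 2 * V\<close>. For \<open>N = 2\<close> the two effects balance
  exactly to first order at \<open>t = t\<^sub>0\<close>, so there the sharper estimate \<open>\<Delta>t \<le> sqrt (t / t\<^sub>0) * \<Delta>V\<close> is needed
  as long as \<open>sqrt (t / t\<^sub>0) \<le> 21/20\<close>.
\<close>

section \<open>One-step decrease of the normalised potential\<close>

text \<open>The cubic Lagrange remainder is nonpositive for \<open>z \<le> 0\<close>. For
  \<open>0 < z \<le> c\<close> it is at most \<open>z ^ 3 / 4\<close>, because
  \<open>exp (1/4) \<le> 3/2\<close>, and one factor \<open>z\<close> is traded for
  \<open>c\<close>. Arbitrarily negative \<open>z\<close> is covered, so later only increases of the
  exponent must be controlled.\<close>

lemma exp_le_quadratic: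
  fixes z c :: real
  assumes "z \<le> c" "0 \<le> c" "c \<le> 1/4"
  shows "exp z \<le> 1 + z + (1/2 + c/4) * z\<^sup>2"
proof -
  obtain s where s: "\<bar>s\<bar> \<le> \<bar>z\<bar>"
    and e: "exp z = (\<Sum>m<3. z ^ m / fact m) + exp s / fact 3 * z ^ 3"
    using Maclaurin_exp_le by blast
  have e': "exp z = 1 + z + z\<^sup>2/2 + exp s / 6 * z ^ 3"
    using e by (simp add: eval_nat_numeral)
  show ?thesis
  proof (cases "z \<le> 0")
    case True
    have "exp s / 6 * z ^ 3 \<le> 0"
      using True by (intro mult_nonneg_nonpos) (auto simp: power3_eq_cube mult_le_0_iff zero_le_mult_iff)
    moreover have "0 \<le> c/4 * z\<^sup>2" using assms by simp
    ultimately show ?thesis using e' by (simp add: algebra_simps)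
  next
    case False
    have "exp s \<le> exp (1/4)" using s assms False by simp
    also have "\<dots> \<le> 1 + 1/4 + (1/4)\<^sup>2" by (rule exp_bound) auto
    also have "\<dots> \<le> 3/2" by (simp add: power2_eq_square)
    finally have "exp s / 6 * z ^ 3 \<le> 1/4 * z ^ 3"
      using False by (intro mult_right_mono) auto
    also have "\<dots> \<le> c/4 * z\<^sup>2"
      using assms(1) False by (simp add: power3_eq_cube power2_eq_square mult_right_mono)
    finally show ?thesis using e' by (simp add: algebra_simps)
  qed
qed

text \<open>With regrets in units of \<open>sqrt t\<close>, the conclusion makes \<open>v\<close> a
  sufficient relative time increment: at time \<open>t * (1 + v)\<close> the potential has fallen
  back to its old value or below. Each exponential is expanded to second order, \<open>orth\<close>
  removes the linear term, and \<open>cond\<close> is what remains to be checked.\<close>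

lemma exp_potential_decrease:
  fixes N :: nat and y al :: "nat \<Rightarrow> real" and v c :: real
  defines "w \<equiv> \<lambda>i. exp ((y i)\<^sup>2 / 2)"
  assumes v: "0 \<le> v" "v \<le> 1/25" and c: "0 \<le> c" "c \<le> 1/4"
    and small: "\<And>i. i < N \<Longrightarrow> y i * al i + (al i)\<^sup>2 / 2 \<le> c"
    and orth: "(\<Sum>i<N. w i * y i * al i) = 0"
    and cond: "(\<Sum>i<N. w i * (al i)\<^sup>2)
        + (1 + c/2) * (\<Sum>i<N. w i * (y i * al i + ((al i)\<^sup>2 - (y i)\<^sup>2 * v) / 2)\<^sup>2)
      \<le> v * (\<Sum>i<N. w i * (1 + (y i)\<^sup>2)) + 37/50 * v\<^sup>2 * (\<Sum>i<N. w i)"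
  shows "(\<Sum>i<N. exp ((y i + al i)\<^sup>2 / (2 * (1 + v)))) \<le> sqrt (1 + v) * (\<Sum>i<N. w i)"
proof -
  \<comment> \<open>\<open>g i\<close> is \<open>1 + v\<close> times the change of the exponent,
    which keeps the expansion free of denominators.\<close>
  define g where "g i = y i * al i + ((al i)\<^sup>2 - (y i)\<^sup>2 * v) / 2" for i
  have w0: "w i > 0" for i by (simp add: w_def)
  define P where "P = (\<Sum>i<N. w i)"
  have P0: "P \<ge> 0" unfolding P_def using w0 by (intro sum_nonneg) (simp add: less_imp_le)
  have v1: "1 + v > 0" using v by simp
  have pt: "(1 + v) * exp ((y i + al i)\<^sup>2 / (2 * (1 + v)))
      \<le> (1 + v) * w i + w i * g i + (1/2 + c/4) * (w i * (g i)\<^sup>2)" if i: "i < N" for i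
  proof -
    define z where "z = g i / (1 + v)"
    have eq: "(y i + al i)\<^sup>2 / (2 * (1 + v)) = (y i)\<^sup>2 / 2 + z"
      using v1 by (simp add: z_def g_def field_simps power2_eq_square)
    have "0 \<le> (y i)\<^sup>2 * v" using v by simp
    then have gc: "g i \<le> c" using small[OF i] unfolding g_def by argo
    have "z \<le> c"
    proof (cases "g i \<le> 0")
      case True
      then have "z \<le> 0" using v1 by (simp add: z_def divide_le_0_iff)
      then show ?thesis using c by simp
    next
      case False
      then have "z \<le> g i" using v by (simp add: z_def divide_le_eq algebra_simps)
      then show ?thesis using gc by simp
    qed
    then have "exp z \<le> 1 + z + (1/2 + c/4) * z\<^sup>2" using exp_le_quadratic c by blast
    then have "(1 + v) * exp z \<le> (1 + v) * (1 + z + (1/2 + c/4) * z\<^sup>2)"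
      using v1 by simp
    also have "\<dots> = (1 + v) + g i + (1/2 + c/4) * ((1 + v) * z\<^sup>2)"
      using v1 by (simp add: z_def distrib_left)
    also have "(1 + v) * z\<^sup>2 = (g i)\<^sup>2 / (1 + v)"
      using v1 by (simp add: z_def power2_eq_square)
    also have "(g i)\<^sup>2 / (1 + v) \<le> (g i)\<^sup>2" using v by (simp add: divide_le_eq distrib_left)
    finally have "(1 + v) * exp z \<le> (1 + v) + g i + (1/2 + c/4) * (g i)\<^sup>2"
      using c by (simp add: mult_left_mono)
    then have "w i * ((1 + v) * exp z) \<le> w i * ((1 + v) + g i + (1/2 + c/4) * (g i)\<^sup>2)"
      using w0[of i] by simp
    moreover have "exp ((y i + al i)\<^sup>2 / (2 * (1 + v))) = w i * exp z"
      unfolding eq by (simp add: w_def exp_add)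
    ultimately show ?thesis by (simp add: algebra_simps)
  qed
  have "(1 + v) * (\<Sum>i<N. exp ((y i + al i)\<^sup>2 / (2 * (1 + v))))
      \<le> (\<Sum>i<N. (1 + v) * w i + w i * g i + (1/2 + c/4) * (w i * (g i)\<^sup>2))"
    unfolding sum_distrib_left using pt by (intro sum_mono) auto
  also have "\<dots> = (1 + v) * P + (\<Sum>i<N. w i * g i) + (1/2 + c/4) * (\<Sum>i<N. w i * (g i)\<^sup>2)"
    by (simp add: sum.distrib sum_distrib_left P_def)
  also have "(\<Sum>i<N. w i * g i)
      = (\<Sum>i<N. w i * y i * al i) + (\<Sum>i<N. w i * (al i)\<^sup>2) / 2 - v * (\<Sum>i<N. w i * (y i)\<^sup>2) / 2"
    unfolding sum_distrib_left sum_divide_distrib sum.distrib[symmetric] sum_subtractf[symmetric]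
    by (intro sum.cong) (auto simp: g_def field_simps)
  finally have 1: "(1 + v) * (\<Sum>i<N. exp ((y i + al i)\<^sup>2 / (2 * (1 + v))))
      \<le> (1 + v) * P + (\<Sum>i<N. w i * (al i)\<^sup>2) / 2 - v * (\<Sum>i<N. w i * (y i)\<^sup>2) / 2
        + (1/2 + c/4) * (\<Sum>i<N. w i * (g i)\<^sup>2)"
    using orth by simp
  have 2: "(\<Sum>i<N. w i * (1 + (y i)\<^sup>2)) = P + (\<Sum>i<N. w i * (y i)\<^sup>2)"
    by (simp add: P_def algebra_simps sum.distrib)
  have 3: "(\<Sum>i<N. w i * (al i)\<^sup>2) + (1 + c/2) * (\<Sum>i<N. w i * (g i)\<^sup>2)
      \<le> v * (P + (\<Sum>i<N. w i * (y i)\<^sup>2)) + 37/50 * v\<^sup>2 * P"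
    using cond unfolding 2 by (simp add: g_def P_def)
  have "(1 + v) * (\<Sum>i<N. exp ((y i + al i)\<^sup>2 / (2 * (1 + v))))
      \<le> (1 + v + v/2 + 37/100 * v\<^sup>2) * P"
    using 1 3 by (simp add: field_simps)
  \<comment> \<open>The function \<open>(1 + v) * sqrt (1 + v)\<close> has second-order coefficient
    \<open>3/8\<close>. The cubic loss is at most \<open>v\<^sup>2 / 200\<close> for
    \<open>v \<le> 1/25\<close>, which leaves \<open>37/100\<close>, half of the
    \<open>37/50\<close> in \<open>cond\<close>.\<close>
  also have "\<dots> \<le> ((1 + v) * sqrt (1 + v)) * P"
  proof (rule mult_right_mono[OF _ P0])
    have "(1 + v/2 - v\<^sup>2/8)\<^sup>2 \<le> 1 + v"
    proof -
      have "v ^ 4 \<le> 8 * v ^ 3" using v by (simp add: eval_nat_numeral mult_right_mono)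
      moreover have "(1 + v/2 - v\<^sup>2/8)\<^sup>2 = 1 + v - v^3/8 + v^4/64" by (simp add: field_simps eval_nat_numeral)
      ultimately show ?thesis using v by simp
    qed
    then have "1 + v/2 - v\<^sup>2/8 \<le> sqrt (1 + v)" by (rule real_le_rsqrt)
    then have "(1 + v) * (1 + v/2 - v\<^sup>2/8) \<le> (1 + v) * sqrt (1 + v)" using v1 by simp
    moreover have "v * v\<^sup>2 \<le> 1/25 * v\<^sup>2" using v by (intro mult_right_mono) auto
    moreover have "(1 + v) * (1 + v/2 - v\<^sup>2/8) = 1 + v + v/2 + 3/8 * v\<^sup>2 - v * v\<^sup>2 / 8"
      by (simp add: field_simps eval_nat_numeral)
    ultimately show "1 + v + v/2 + 37/100 * v\<^sup>2 \<le> (1 + v) * sqrt (1 + v)" by simp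
  qed
  finally show ?thesis using v1 by (simp add: P_def mult.assoc)
qed

text \<open>\<open>A / Q\<close> is the variance increment divided by the time, so
  \<open>\<delta>\<close> is the relative excess of elapsed time over variance.
  \<open>\<theta>\<close> is the weight of Young's inequality, \<open>\<sigma>\<close> bounds
  \<open>y\<^sup>2 / (1 + y\<^sup>2)\<close>, and \<open>b2\<close>, \<open>g2\<close> control the
  fourth-order terms; \<open>cond\<close> says that all these errors fit into
  \<open>\<delta>\<close>.\<close>

lemma quadratic_condition_generic:
  fixes N :: nat and w y al :: "nat \<Rightarrow> real" and v \<kappa> \<theta> \<delta> \<sigma> b2 g2 :: real
  defines "Q \<equiv> \<Sum>i<N. w i * (1 + (y i)\<^sup>2)"
    and "A \<equiv> \<Sum>i<N. w i * (1 + (y i)\<^sup>2) * (al i)\<^sup>2"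
  assumes N: "N \<ge> 1" and w0: "\<And>i. w i > 0" and v: "v = (1 + \<delta>) * A / Q"
    and b2: "\<And>i. i < N \<Longrightarrow> (al i)\<^sup>2 \<le> b2"
    and g2: "\<And>i. i < N \<Longrightarrow> (y i)\<^sup>2 * b2 \<le> g2"
    and \<sigma>: "\<And>i. i < N \<Longrightarrow> (y i)\<^sup>2 \<le> \<sigma> * (1 + (y i)\<^sup>2)"
    and pos: "0 \<le> \<delta>" "0 \<le> \<kappa>" "0 < \<theta>"
    and cond: "((1 + \<kappa>) * (1 + \<theta>) - 1) * \<sigma> + (1 + \<kappa>) * ((1 + 1/\<theta>) / 4) * (b2 + (1 + \<delta>)\<^sup>2 * g2) \<le> \<delta>"
  shows "v \<le> (1 + \<delta>) * b2"
    and "(\<Sum>i<N. w i * (al i)\<^sup>2)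
        + (1 + \<kappa>) * (\<Sum>i<N. w i * (y i * al i + ((al i)\<^sup>2 - (y i)\<^sup>2 * v) / 2)\<^sup>2) \<le> v * Q"
proof -
  have wy0: "w i * (1 + (y i)\<^sup>2) > 0" for i using w0[of i] by (simp add: add_pos_nonneg)
  have Q0: "Q > 0" unfolding Q_def using N wy0 by (intro sum_pos) (auto simp: lessThan_empty_iff)
  have A0: "A \<ge> 0" unfolding A_def using wy0 by (intro sum_nonneg) (simp add: less_imp_le)
  have AQ: "A \<le> b2 * Q" unfolding A_def Q_def sum_distrib_left
    using mult_left_mono[OF b2 less_imp_le[OF wy0]] by (intro sum_mono) (simp add: mult.commute)
  have v0: "v \<ge> 0" using v A0 Q0 pos by simp
  show vb: "v \<le> (1 + \<delta>) * b2"
    using mult_left_mono[OF AQ, of "1 + \<delta>"] pos Q0 by (simp add: v divide_le_eq mult.assoc)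
  define h where "h i = ((al i)\<^sup>2 - (y i)\<^sup>2 * v) / 2" for i
  have pt: "w i * (y i * al i + h i)\<^sup>2 \<le> (1 + \<theta>) * (w i * (y i)\<^sup>2 * (al i)\<^sup>2)
      + (1 + 1/\<theta>) / 4 * (b2 * (w i * (al i)\<^sup>2) + (1 + \<delta>) * g2 * (v * (w i * (y i)\<^sup>2)))"
    if i: "i < N" for i
  proof -
    \<comment> \<open>Young's inequality by completing the square: it separates the linear part
      \<open>y i * al i\<close> from the second-order part \<open>h i\<close>.\<close>
    have "(y i * al i + h i)\<^sup>2 = (1 + \<theta>) * (y i * al i)\<^sup>2 + (1 + 1/\<theta>) * (h i)\<^sup>2
        - (\<theta> * (y i * al i) - h i)\<^sup>2 / \<theta>"
      using pos(3) by (simp add: field_simps power2_eq_square)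
    then have 1: "(y i * al i + h i)\<^sup>2 \<le> (1 + \<theta>) * (y i * al i)\<^sup>2 + (1 + 1/\<theta>) * (h i)\<^sup>2"
      using pos(3) by simp
    have "(h i)\<^sup>2 \<le> ((al i)\<^sup>2 * (al i)\<^sup>2 + ((y i)\<^sup>2 * v) * ((y i)\<^sup>2 * v)) / 4"
    proof -
      have "0 \<le> (al i)\<^sup>2 * ((y i)\<^sup>2 * v)" using v0 by simp
      then show ?thesis by (simp add: h_def power2_eq_square field_simps)
    qed
    also have "\<dots> \<le> (b2 * (al i)\<^sup>2 + ((1 + \<delta>) * g2) * ((y i)\<^sup>2 * v)) / 4"
    proof -
      have "(y i)\<^sup>2 * v \<le> (y i)\<^sup>2 * ((1 + \<delta>) * b2)" using vb by (intro mult_left_mono) auto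
      also have "\<dots> = (1 + \<delta>) * ((y i)\<^sup>2 * b2)" by simp
      also have "\<dots> \<le> (1 + \<delta>) * g2" using g2[OF i] pos by (intro mult_left_mono) auto
      finally have "((y i)\<^sup>2 * v) * ((y i)\<^sup>2 * v) \<le> ((1 + \<delta>) * g2) * ((y i)\<^sup>2 * v)"
        using v0 by (intro mult_right_mono) auto
      moreover have "(al i)\<^sup>2 * (al i)\<^sup>2 \<le> b2 * (al i)\<^sup>2" using b2[OF i] by (intro mult_right_mono) auto
      ultimately show ?thesis by simp
    qed
    finally have "(1 + 1/\<theta>) * (h i)\<^sup>2 \<le> (1 + 1/\<theta>) * ((b2 * (al i)\<^sup>2 + ((1 + \<delta>) * g2) * ((y i)\<^sup>2 * v)) / 4)"
      using pos(3) by (intro mult_left_mono) auto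
    with 1 have "(y i * al i + h i)\<^sup>2 \<le> (1 + \<theta>) * (y i * al i)\<^sup>2
        + (1 + 1/\<theta>) * ((b2 * (al i)\<^sup>2 + ((1 + \<delta>) * g2) * ((y i)\<^sup>2 * v)) / 4)" by linarith
    then have "w i * (y i * al i + h i)\<^sup>2 \<le> w i * ((1 + \<theta>) * (y i * al i)\<^sup>2
        + (1 + 1/\<theta>) * ((b2 * (al i)\<^sup>2 + ((1 + \<delta>) * g2) * ((y i)\<^sup>2 * v)) / 4))"
      using w0[of i] by simp
    also have "\<dots> = (1 + \<theta>) * (w i * (y i)\<^sup>2 * (al i)\<^sup>2)
      + (1 + 1/\<theta>) / 4 * (b2 * (w i * (al i)\<^sup>2) + (1 + \<delta>) * g2 * (v * (w i * (y i)\<^sup>2)))"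
      by (simp add: power_mult_distrib algebra_simps add_divide_distrib)
    finally show ?thesis .
  qed
  define A1 where "A1 = (\<Sum>i<N. w i * (al i)\<^sup>2)"
  define A2 where "A2 = (\<Sum>i<N. w i * (y i)\<^sup>2 * (al i)\<^sup>2)"
  define Y where "Y = (\<Sum>i<N. w i * (y i)\<^sup>2)"
  define G where "G = (\<Sum>i<N. w i * (y i * al i + h i)\<^sup>2)"
  have G: "G \<le> (1 + \<theta>) * A2 + (1 + 1/\<theta>) / 4 * (b2 * A1 + (1 + \<delta>) * g2 * (v * Y))"
    unfolding G_def A1_def A2_def Y_def sum_distrib_left sum.distrib[symmetric]
    using pt by (intro sum_mono) (simp add: sum_distrib_left)
  have AA: "A = A1 + A2" by (simp add: A_def A1_def A2_def algebra_simps sum.distrib)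
  have A20: "A2 \<ge> 0" unfolding A2_def using w0 by (intro sum_nonneg) (simp add: less_imp_le)
  have A1A: "A1 \<le> A" using AA A20 by simp
  have A2A: "A2 \<le> \<sigma> * A" unfolding A2_def A_def sum_distrib_left
  proof (intro sum_mono)
    fix i assume "i \<in> {..<N}"
    then have "(w i * (al i)\<^sup>2) * (y i)\<^sup>2 \<le> (w i * (al i)\<^sup>2) * (\<sigma> * (1 + (y i)\<^sup>2))"
      using \<sigma> w0[of i] by (intro mult_left_mono) auto
    then show "w i * (y i)\<^sup>2 * (al i)\<^sup>2 \<le> \<sigma> * (w i * (1 + (y i)\<^sup>2) * (al i)\<^sup>2)" by (simp add: mult_ac)
  qed
  have "Y \<le> Q" unfolding Y_def Q_def using w0 by (intro sum_mono) (simp add: less_imp_le)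
  then have "v * Y \<le> v * Q" using v0 by (rule mult_left_mono)
  then have vY: "v * Y \<le> (1 + \<delta>) * A" and vQ: "v * Q = (1 + \<delta>) * A" using Q0 v by simp_all
  obtain i where "i < N" using N by (metis less_eq_Suc_le One_nat_def)
  then have b20: "b2 \<ge> 0" and g20: "g2 \<ge> 0"
    using order_trans[OF zero_le_power2 b2[of i]] order_trans[OF mult_nonneg_nonneg g2[of i]] by auto
  have "b2 * A1 + (1 + \<delta>) * g2 * (v * Y) \<le> b2 * A + (1 + \<delta>) * g2 * ((1 + \<delta>) * A)"
    using A1A vY b20 g20 pos by (intro add_mono mult_left_mono) auto
  also have "\<dots> = (b2 + (1 + \<delta>)\<^sup>2 * g2) * A" by (simp add: power2_eq_square algebra_simps)
  finally have b: "b2 * A1 + (1 + \<delta>) * g2 * (v * Y) \<le> (b2 + (1 + \<delta>)\<^sup>2 * g2) * A" .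
  have "(1 + 1/\<theta>) / 4 * (b2 * A1 + (1 + \<delta>) * g2 * (v * Y)) \<le> (1 + 1/\<theta>) / 4 * ((b2 + (1 + \<delta>)\<^sup>2 * g2) * A)"
    using b pos by (intro mult_left_mono) auto
  with G have "G \<le> (1 + \<theta>) * A2 + (1 + 1/\<theta>) / 4 * ((b2 + (1 + \<delta>)\<^sup>2 * g2) * A)" by linarith
  then have G': "(1 + \<kappa>) * G \<le> (1 + \<kappa>) * ((1 + \<theta>) * A2 + (1 + 1/\<theta>) / 4 * ((b2 + (1 + \<delta>)\<^sup>2 * g2) * A))"
    using pos by (intro mult_left_mono) auto
  \<comment> \<open>Since \<open>A = A1 + A2\<close>, one copy of \<open>A2\<close> belongs to the
    budget. Only the excess coefficient \<open>C1\<close> is an error, and it is damped by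
    \<open>\<sigma>\<close>.\<close>
  define C1 where "C1 = (1 + \<kappa>) * (1 + \<theta>) - 1"
  define C2 where "C2 = (1 + \<kappa>) * ((1 + 1/\<theta>) / 4) * (b2 + (1 + \<delta>)\<^sup>2 * g2)"
  have "C1 = \<kappa> + \<theta> + \<kappa> * \<theta>" by (simp add: C1_def algebra_simps)
  then have C10: "0 \<le> C1" using pos by simp
  have "(1 + \<kappa>) * ((1 + \<theta>) * A2 + (1 + 1/\<theta>) / 4 * ((b2 + (1 + \<delta>)\<^sup>2 * g2) * A))
      = (1 + \<kappa>) * (1 + \<theta>) * A2 + C2 * A"
    unfolding C2_def by (simp only: distrib_left[of "1 + \<kappa>" "(1 + \<theta>) * A2"] mult.assoc)
  also have "(1 + \<kappa>) * (1 + \<theta>) = C1 + 1" by (simp add: C1_def)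
  also have "(C1 + 1) * A2 = C1 * A2 + A2" by (simp add: distrib_right)
  finally have "A1 + (1 + \<kappa>) * G \<le> A + C1 * A2 + C2 * A" using G' AA by linarith
  also have "C1 * A2 \<le> C1 * (\<sigma> * A)" using A2A C10 by (rule mult_left_mono)
  also have "A + C1 * (\<sigma> * A) + C2 * A = A + (C1 * \<sigma> + C2) * A" by (simp add: distrib_right)
  also have "\<dots> \<le> A + \<delta> * A" using cond A0 unfolding C1_def C2_def by (intro add_left_mono mult_right_mono)
  finally have "A1 + (1 + \<kappa>) * G \<le> v * Q" using vQ by (simp add: distrib_right)
  then show "(\<Sum>i<N. w i * (al i)\<^sup>2)
        + (1 + \<kappa>) * (\<Sum>i<N. w i * (y i * al i + ((al i)\<^sup>2 - (y i)\<^sup>2 * v) / 2)\<^sup>2) \<le> v * Q"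
    by (simp add: A1_def G_def h_def)
qed

text \<open>
  Here the error term is of relative size \<open>S\<close>, even when \<open>S\<close> is small compared with \<open>b\<^sup>2\<close>: the only
  dangerous term is the cubic one, \<open>T1\<close>, and AM-GM bounds it by \<open>S * A\<close> plus a fraction of the
  gain \<open>v\<^sup>2\<close>.
\<close>

lemma two_expert_quadratic_condition:
  fixes y1 y2 p1 p2 b v :: real
  defines "w1 \<equiv> exp (y1\<^sup>2 / 2)" and "w2 \<equiv> exp (y2\<^sup>2 / 2)" and "S \<equiv> y1\<^sup>2 + y2\<^sup>2"
  defines "A \<equiv> w1 * (1 + y1\<^sup>2) * (p2 * b)\<^sup>2 + w2 * (1 + y2\<^sup>2) * (p1 * b)\<^sup>2"
    and "Q \<equiv> w1 * (1 + y1\<^sup>2) + w2 * (1 + y2\<^sup>2)"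
  assumes y: "0 \<le> y1" "0 \<le> y2" and p: "0 \<le> p1" "0 \<le> p2" "p1 + p2 = 1"
    and bal: "w1 * y1 * p2 = w2 * y2 * p1"
    and S: "S \<le> 3/200" and b: "b\<^sup>2 \<le> 1/2600" and v: "v = (1 + S/4) * A / Q"
  shows "w1 * (p2 * b)\<^sup>2 + w2 * (p1 * b)\<^sup>2
      + (1 + 1/500) * (w1 * (y1 * (p2 * b) + ((p2 * b)\<^sup>2 - y1\<^sup>2 * v) / 2)\<^sup>2
                     + w2 * (y2 * (- p1 * b) + ((p1 * b)\<^sup>2 - y2\<^sup>2 * v) / 2)\<^sup>2)
    \<le> v * Q + 37/50 * v\<^sup>2 * (w1 + w2)"
proof -
  have S0: "0 \<le> S" by (simp add: S_def)
  have yS: "y1\<^sup>2 \<le> S" "y2\<^sup>2 \<le> S" by (simp_all add: S_def)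
  have wb: "1 \<le> exp (a\<^sup>2/2) \<and> exp (a\<^sup>2/2) \<le> 126/125" if "a\<^sup>2 \<le> S" for a :: real
  proof -
    have "exp (a\<^sup>2/2) \<le> exp (3/400)" using that S by simp
    also have "\<dots> \<le> 1 + 3/400 + (3/400)\<^sup>2" by (rule exp_bound) auto
    also have "\<dots> \<le> 126/125" by (simp add: power2_eq_square)
    finally show ?thesis by simp
  qed
  have w: "1 \<le> w1" "1 \<le> w2" "w1 \<le> 126/125" "w2 \<le> 126/125"
    using wb yS by (auto simp: w1_def w2_def)
  define c where "c = p1 * p2"
  define n where "n = p1\<^sup>2 + p2\<^sup>2"
  \<comment> \<open>In terms of the imbalance \<open>D\<close>, both \<open>c\<close> and
    \<open>n\<close> are quadratics, so the estimate of the cubic term becomes an inequality in one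
    variable.\<close>
  define D where "D = p2 - p1"
  define K where "K = w1 * y1 + w2 * y2"
  have p1_eq: "p1 = (1 - D) / 2" and p2_eq: "p2 = (1 + D) / 2" using p(3) by (auto simp: D_def)
  have cD: "c = (1 - D\<^sup>2) / 4" and nD: "n = (1 + D\<^sup>2) / 2"
    by (simp_all add: c_def n_def p1_eq p2_eq field_simps power2_eq_square)
  have c0: "0 \<le> c" "c \<le> 1/4" using p cD by (simp_all add: c_def)
  have n0: "1/2 \<le> n" using nD by simp
  \<comment> \<open>Balance and \<open>p1 + p2 = 1\<close> make \<open>w1 * y1\<close>,
    \<open>w2 * y2\<close> proportional to \<open>p1\<close>, \<open>p2\<close>; the cross terms
    below then share the factor \<open>K\<close>, which \<open>Kn\<close> shows to be of order
    \<open>sqrt S\<close>.\<close>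
  have K1: "w1 * y1 = K * p1" and K2: "w2 * y2 = K * p2"
    using bal p(3) unfolding K_def by (metis distrib_left distrib_right mult.commute mult.right_neutral)+
  have K0: "0 \<le> K" using w y by (simp add: K_def)
  have Kn: "K\<^sup>2 * n \<le> 1017/1000 * S"
  proof -
    have "K\<^sup>2 * n = w1\<^sup>2 * y1\<^sup>2 + w2\<^sup>2 * y2\<^sup>2"
      unfolding n_def distrib_left power_mult_distrib[symmetric] K1 K2 ..
    also have "\<dots> \<le> (126/125)\<^sup>2 * y1\<^sup>2 + (126/125)\<^sup>2 * y2\<^sup>2"
      using w by (intro add_mono mult_right_mono power_mono) auto
    also have "\<dots> = (126/125)\<^sup>2 * S" by (simp only: S_def distrib_left)
    also have "\<dots> \<le> 1017/1000 * S" using S0 by (intro mult_right_mono) (simp_all add: power2_eq_square)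
    finally show ?thesis .
  qed
  have K_small: "K \<le> 1/5"
  proof -
    have "K\<^sup>2 * (1/2) \<le> K\<^sup>2 * n" using n0 by (intro mult_left_mono) auto
    then have "K\<^sup>2 \<le> (1/5)\<^sup>2" using Kn S by (simp add: power2_eq_square)
    then show ?thesis by (rule power2_le_imp_le) simp
  qed
  have b_small: "\<bar>b\<bar> \<le> 1/50"
  proof -
    have "\<bar>b\<bar>\<^sup>2 \<le> (1/50)\<^sup>2" using b by (simp add: power2_eq_square)
    then show ?thesis by (rule power2_le_imp_le) simp
  qed
  have Abn: "b\<^sup>2 * n \<le> A"
  proof -
    have "1 * (p2*b)\<^sup>2 \<le> (w1 * (1 + y1\<^sup>2)) * (p2 * b)\<^sup>2"
      using w mult_mono[of 1 w1 1 "1 + y1\<^sup>2"] by (intro mult_right_mono) auto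
    moreover have "1 * (p1*b)\<^sup>2 \<le> (w2 * (1 + y2\<^sup>2)) * (p1 * b)\<^sup>2"
      using w mult_mono[of 1 w2 1 "1 + y2\<^sup>2"] by (intro mult_right_mono) auto
    ultimately show ?thesis by (simp add: A_def n_def power_mult_distrib algebra_simps)
  qed
  have A0: "0 \<le> A" using Abn n0 by (meson order_trans mult_nonneg_nonneg zero_le_power2 zero_le_divide_1_iff zero_le_numeral)
  have Q2: "2 \<le> Q" unfolding Q_def
    using w mult_mono[of 1 w1 1 "1 + y1\<^sup>2"] mult_mono[of 1 w2 1 "1 + y2\<^sup>2"] by auto
  have Qup: "Q \<le> 2032/1000"
  proof -
    have "Q \<le> 126/125 * (1 + y1\<^sup>2) + 126/125 * (1 + y2\<^sup>2)"
      unfolding Q_def using w by (intro add_mono mult_right_mono) auto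
    also have "\<dots> = 126/125 * (2 + S)" unfolding S_def by argo
    finally show ?thesis using S by simp
  qed
  have p01: "p1\<^sup>2 \<le> 1" "p2\<^sup>2 \<le> 1" using p by (auto simp: abs_square_le_1)
  have AQ: "A \<le> b\<^sup>2 * Q"
  proof -
    have "(w1 * (1 + y1\<^sup>2)) * (p2 * b)\<^sup>2 \<le> (w1 * (1 + y1\<^sup>2)) * b\<^sup>2"
      using w p01 by (intro mult_left_mono) (auto simp: power_mult_distrib mult_left_le_one_le)
    moreover have "(w2 * (1 + y2\<^sup>2)) * (p1 * b)\<^sup>2 \<le> (w2 * (1 + y2\<^sup>2)) * b\<^sup>2"
      using w p01 by (intro mult_left_mono) (auto simp: power_mult_distrib mult_left_le_one_le)
    ultimately show ?thesis by (simp add: A_def Q_def algebra_simps)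
  qed
  have v0: "0 \<le> v" using v S0 A0 Q2 by simp
  have vA: "v \<le> 51/100 * A"
  proof -
    have "(1 + S/4) * A \<le> (102/100) * A" using S A0 by (intro mult_right_mono) auto
    also have "\<dots> = 51/100 * A * 2" by simp
    also have "\<dots> \<le> 51/100 * A * Q" using Q2 A0 by (intro mult_left_mono) auto
    finally show ?thesis using Q2 v by (simp add: divide_le_eq)
  qed
  have v_small: "v \<le> 1/2000"
  proof -
    have "A \<le> 1/2600 * Q" using AQ b Q2 by (meson order_trans mult_right_mono zero_le_numeral)
    then have "A \<le> 1/2600 * (2032/1000)" using Qup by simp
    then show ?thesis using vA by simp
  qed
  have "v * Q = (1 + S/4) * A" using v Q2 by simp
  then have vQ: "v * Q = A + S/4 * A" by (simp only: distrib_right mult_1_left)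
  \<comment> \<open>This lower bound on \<open>v\<close> turns the gain of order
    \<open>v\<^sup>2\<close> into a multiple of \<open>E\<^sup>2\<close>, which pays for the terms
    that carry no factor \<open>S\<close>.\<close>
  have v_low: "b\<^sup>2 * n \<le> 2032/1000 * v"
  proof -
    have "A \<le> v * Q" using vQ S0 A0 by simp
    also have "\<dots> \<le> v * (2032/1000)" using Qup v0 by (intro mult_left_mono)
    finally show ?thesis using Abn by simp
  qed
  define E where "E = b\<^sup>2 * n"
  have E0: "0 \<le> E" using n0 by (simp add: E_def)
  have gain: "358/1000 * E\<^sup>2 \<le> 37/50 * v\<^sup>2 * (w1 + w2)"
  proof -
    have "E\<^sup>2 \<le> (2032/1000 * v)\<^sup>2" using v_low E0 by (intro power_mono) (auto simp: E_def)
    then have "E\<^sup>2 \<le> (2032/1000)\<^sup>2 * v\<^sup>2" by (simp only: power_mult_distrib)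
    then have "358/1000 * E\<^sup>2 \<le> 358/1000 * ((2032/1000)\<^sup>2 * v\<^sup>2)" by (rule mult_left_mono) simp
    also have "\<dots> = (358/1000 * (2032/1000)\<^sup>2) * v\<^sup>2" by (simp only: mult.assoc)
    also have "\<dots> \<le> 74/50 * v\<^sup>2" by (intro mult_right_mono) (simp_all add: power2_eq_square)
    also have "\<dots> = 37/50 * v\<^sup>2 * 2" by simp
    also have "\<dots> \<le> 37/50 * v\<^sup>2 * (w1 + w2)" using w by (intro mult_left_mono) auto
    finally show ?thesis .
  qed
  \<comment> \<open>\<open>Y\<close> is the difference between \<open>A\<close> and the plain sum of
    squared increments; \<open>T1\<close> and \<open>T2\<close> are the cross terms of the linear
    part with the squared increment and with the time change; \<open>H\<close> is the square of the
    second-order part.\<close>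
  define Y where "Y = w1 * (y1 * (p2 * b))\<^sup>2 + w2 * (y2 * (p1 * b))\<^sup>2"
  define H where "H = w1 * (((p2 * b)\<^sup>2 - y1\<^sup>2 * v) / 2)\<^sup>2 + w2 * (((p1 * b)\<^sup>2 - y2\<^sup>2 * v) / 2)\<^sup>2"
  define T1 where "T1 = K * b^3 * c * D"
  define T2 where "T2 = v * b * K * c * (y1\<^sup>2 - y2\<^sup>2)"
  have expand: "w1 * (y1 * (p2 * b) + ((p2 * b)\<^sup>2 - y1\<^sup>2 * v) / 2)\<^sup>2
      + w2 * (y2 * (- p1 * b) + ((p1 * b)\<^sup>2 - y2\<^sup>2 * v) / 2)\<^sup>2 = Y + T1 - T2 + H"
  proof -
    have "w1 * (y1 * (p2 * b) + ((p2 * b)\<^sup>2 - y1\<^sup>2 * v) / 2)\<^sup>2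
      + w2 * (y2 * (- p1 * b) + ((p1 * b)\<^sup>2 - y2\<^sup>2 * v) / 2)\<^sup>2
      = Y + ((w1 * y1) * (p2 * b) * ((p2 * b)\<^sup>2 - y1\<^sup>2 * v) - (w2 * y2) * (p1 * b) * ((p1 * b)\<^sup>2 - y2\<^sup>2 * v)) + H"
      by (simp add: Y_def H_def power2_eq_square field_simps)
    also have "(w1 * y1) * (p2 * b) * ((p2 * b)\<^sup>2 - y1\<^sup>2 * v) - (w2 * y2) * (p1 * b) * ((p1 * b)\<^sup>2 - y2\<^sup>2 * v)
      = K * b^3 * c * ((p2 + p1) * D) - T2"
      unfolding K1 K2 by (simp add: T2_def c_def D_def power2_eq_square power3_eq_cube algebra_simps)
    also have "(p2 + p1) * D = D" using p(3) by simp
    finally show ?thesis by (simp add: T1_def)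
  qed
  have Yb: "Y \<le> S * A"
  proof -
    have "w1 * (y1 * (p2 * b))\<^sup>2 \<le> S * (w1 * (1 + y1\<^sup>2) * (p2 * b)\<^sup>2)"
      and "w2 * (y2 * (p1 * b))\<^sup>2 \<le> S * (w2 * (1 + y2\<^sup>2) * (p1 * b)\<^sup>2)"
    proof -
      have *: "w * (y * a)\<^sup>2 \<le> S * (w * (1 + y\<^sup>2) * a\<^sup>2)" if "y\<^sup>2 \<le> S" "1 \<le> w" for w y a :: real
      proof -
        have "y\<^sup>2 \<le> S * (1 + y\<^sup>2)" using that S0 by (simp add: algebra_simps add_increasing2)
        then have "(w * a\<^sup>2) * y\<^sup>2 \<le> (w * a\<^sup>2) * (S * (1 + y\<^sup>2))" using that by (intro mult_left_mono) auto
        then show ?thesis by (simp add: power_mult_distrib mult_ac)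
      qed
      show "w1 * (y1 * (p2 * b))\<^sup>2 \<le> S * (w1 * (1 + y1\<^sup>2) * (p2 * b)\<^sup>2)"
        and "w2 * (y2 * (p1 * b))\<^sup>2 \<le> S * (w2 * (1 + y2\<^sup>2) * (p1 * b)\<^sup>2)"
        using * yS w by auto
    qed
    then show ?thesis by (simp add: Y_def A_def distrib_left)
  qed
  have Y0: "0 \<le> Y" using w by (simp add: Y_def)
  have T1b: "T1 \<le> 191/1000 * (S * A) + 84/1000 * E\<^sup>2"
  proof -
    \<comment> \<open>With \<open>a = \<bar>D\<bar>\<close>, the claim is
      \<open>4 * a * (1 - a\<^sup>2) \<le> (1 + a\<^sup>2)\<^sup>2\<close>, and the difference of
      the two sides is a perfect square.\<close>
    have cDn: "c * \<bar>D\<bar> \<le> n\<^sup>2 / 4"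
    proof -
      have "0 \<le> (\<bar>D\<bar>\<^sup>2 + 2 * \<bar>D\<bar> - 1)\<^sup>2" by simp
      also have "\<dots> = (1 + \<bar>D\<bar>\<^sup>2)\<^sup>2 - 4 * \<bar>D\<bar> * (1 - \<bar>D\<bar>\<^sup>2)"
        by (simp only: power2_eq_square) (simp add: algebra_simps del: abs_mult_self_eq)
      finally show ?thesis unfolding cD nD by (simp add: power2_eq_square field_simps)
    qed
    have "T1 \<le> \<bar>T1\<bar>" by simp
    also have "\<bar>T1\<bar> = (K * \<bar>b\<bar>) * b\<^sup>2 * (c * \<bar>D\<bar>)"
      using K0 c0 by (simp add: T1_def abs_mult power_abs eval_nat_numeral)
    also have "\<dots> \<le> (K * \<bar>b\<bar>) * b\<^sup>2 * (n\<^sup>2 / 4)" using cDn K0 by (intro mult_left_mono) auto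
    \<comment> \<open>The AM-GM weight \<open>3/2\<close> is tuned so that the share of
      \<open>S * A\<close> stays below \<open>1/4\<close>, while the share \<open>1/12\<close> of
      \<open>E\<^sup>2\<close>, together with about \<open>1/4\<close> from \<open>H\<close>, stays
      below the gain \<open>358/1000\<close>.\<close>
    also have "\<dots> \<le> ((3/2 * K\<^sup>2 + 2/3 * b\<^sup>2) / 2) * b\<^sup>2 * (n\<^sup>2 / 4)"
    proof (intro mult_right_mono)
      have "0 \<le> (3/2 * K - \<bar>b\<bar>)\<^sup>2" by simp
      then show "K * \<bar>b\<bar> \<le> (3/2 * K\<^sup>2 + 2/3 * b\<^sup>2) / 2" by (simp add: power2_diff power2_eq_square algebra_simps)
    qed auto
    also have "\<dots> = 3/16 * (K\<^sup>2 * n) * E + 1/12 * E\<^sup>2"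
      by (simp add: E_def power2_eq_square field_simps)
    also have "3/16 * (K\<^sup>2 * n) * E \<le> 3/16 * (1017/1000 * S) * A"
      using Kn Abn E0 S0 unfolding E_def by (intro mult_mono[OF mult_left_mono[OF Kn]]) auto
    finally have "T1 \<le> 3/16 * (1017/1000 * S) * A + 1/12 * E\<^sup>2" by simp
    moreover have "3/16 * (1017/1000 * S) * A = 3051/16000 * (S * A)" by simp
    moreover have "0 \<le> S * A" "0 \<le> E\<^sup>2" using S0 A0 by auto
    ultimately show ?thesis by linarith
  qed
  have T2b: "- T2 \<le> 1/1000 * (S * A)"
  proof -
    have "- T2 \<le> \<bar>T2\<bar>" by simp
    also have "\<bar>T2\<bar> = v * (\<bar>b\<bar> * K * c) * \<bar>y1\<^sup>2 - y2\<^sup>2\<bar>"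
      using K0 c0 v0 by (simp add: T2_def abs_mult)
    also have "\<dots> \<le> (51/100 * A) * (1/50 * (1/5) * (1/4)) * S"
      using K0 c0 v0 vA A0 b_small K_small by (intro mult_mono) (auto simp: S_def abs_le_iff)
    also have "\<dots> \<le> 1/1000 * (S * A)" using S0 A0 by (simp add: mult_ac)
    finally show ?thesis .
  qed
  have Hb: "H \<le> 252/1000 * E\<^sup>2 + 1/1000 * (S * A)"
  proof -
    have *: "w * ((a - y * v) / 2)\<^sup>2 \<le> 252/1000 * (a\<^sup>2 + (y * v)\<^sup>2)"
      if "1 \<le> w" "w \<le> 126/125" "0 \<le> y" "0 \<le> a" for w a y
    proof -
      have "0 \<le> a * (y * v)" using that v0 by simp
      then have "((a - y * v) / 2)\<^sup>2 \<le> (a\<^sup>2 + (y * v)\<^sup>2) / 4" by (simp add: power2_eq_square field_simps)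
      then have "w * ((a - y * v) / 2)\<^sup>2 \<le> 126/125 * ((a\<^sup>2 + (y * v)\<^sup>2) / 4)"
        using that by (intro mult_mono) auto
      then show ?thesis by simp
    qed
    have "H \<le> 252/1000 * (((p2 * b)\<^sup>2)\<^sup>2 + (y1\<^sup>2 * v)\<^sup>2) + 252/1000 * (((p1 * b)\<^sup>2)\<^sup>2 + (y2\<^sup>2 * v)\<^sup>2)"
      unfolding H_def using w by (intro add_mono *) auto
    also have "\<dots> = 252/1000 * (((p2 * b)\<^sup>2)\<^sup>2 + ((p1 * b)\<^sup>2)\<^sup>2) + 252/1000 * ((y1\<^sup>2)\<^sup>2 + (y2\<^sup>2)\<^sup>2) * v\<^sup>2"
      by (simp add: power_mult_distrib algebra_simps)
    also have "((p2 * b)\<^sup>2)\<^sup>2 + ((p1 * b)\<^sup>2)\<^sup>2 \<le> E\<^sup>2"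
    proof -
      have "E = (p2 * b)\<^sup>2 + (p1 * b)\<^sup>2" by (simp add: E_def n_def power_mult_distrib algebra_simps)
      then show ?thesis by (simp add: power2_sum)
    qed
    also have "(y1\<^sup>2)\<^sup>2 + (y2\<^sup>2)\<^sup>2 \<le> S\<^sup>2" by (simp add: S_def power2_sum)
    also have "252/1000 * S\<^sup>2 * v\<^sup>2 \<le> 1/1000 * (S * A)"
    proof -
      have "S * v \<le> 3/200 * (1/2000)" using S S0 v0 v_small by (intro mult_mono) auto
      then have "252/1000 * (S * v) \<le> 1/1000" by simp
      then have "(252/1000 * (S * v)) * (S * v) \<le> 1/1000 * (S * A)"
        using S0 v0 vA A0 by (intro mult_mono mult_left_mono) auto
      then show ?thesis by (simp add: power2_eq_square mult_ac)
    qed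
    finally show ?thesis by (simp add: mult_right_mono)
  qed
  have AY: "w1 * (p2 * b)\<^sup>2 + w2 * (p1 * b)\<^sup>2 + Y = A"
    by (simp add: Y_def A_def power_mult_distrib algebra_simps)
  define G where "G = Y + T1 - T2 + H"
  \<comment> \<open>Budget: beyond \<open>A\<close>, the terms cost about \<open>0.196\<close> of
    \<open>S * A\<close> against the available \<open>1/4\<close>, and about \<open>0.337\<close> of
    \<open>E\<^sup>2\<close> against \<open>0.358\<close>.\<close>
  have "(1 + 1/500) * G = G + 1/500 * G" by argo
  moreover have "S/4 * A = 1/4 * (S * A)" by simp
  moreover have "0 \<le> S * A" "0 \<le> E\<^sup>2" using S0 A0 by auto
  ultimately show ?thesis
    unfolding expand vQ G_def[symmetric] using AY Yb T1b T2b Hb gain G_def by linarith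
qed

section \<open>The potential and the existence of runs\<close>

lemma proj_nonneg: "proj {0..} y = max y 0"
  unfolding proj_def
proof (rule the_equality)
  show "max y 0 \<in> {0..} \<and> (\<forall>w\<in>{0..}. \<bar>y - max y 0\<bar> \<le> \<bar>y - w\<bar>)" by auto
next
  fix z assume z: "z \<in> {0..} \<and> (\<forall>w\<in>{0..}. \<bar>y - z\<bar> \<le> \<bar>y - w\<bar>)"
  then have "0 \<le> z" by simp
  moreover have "\<bar>y - z\<bar> \<le> \<bar>y - max y 0\<bar>" using conjunct2[OF z] by (rule bspec) simp
  ultimately show "z = max y 0" by (auto simp: max_def split: if_splits)
qed

section \<open>Derivatives and monotonicity of the potential\<close>

lemma phi_NH_eq: "t > 0 \<Longrightarrow> phi_NH y t = exp (y\<^sup>2 / (2 * t)) / sqrt t"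
  by (simp add: phi_NH_def powr_minus_divide powr_half_sqrt)

lemma phi_NH_pos: "t > 0 \<Longrightarrow> phi_NH y t > 0"
  by (simp add: phi_NH_eq)

lemma phi_NH_has_derivative:
  "t > 0 \<Longrightarrow> ((\<lambda>z. phi_NH z t) has_real_derivative (y / t * phi_NH y t)) (at y)"
  unfolding phi_NH_def by (auto intro!: derivative_eq_intros)

lemma dphi_NH: "t > 0 \<Longrightarrow> dphi phi_NH y t = y / t * phi_NH y t"
  unfolding dphi_def by (rule DERIV_imp_deriv) (rule phi_NH_has_derivative)

lemma ddphi_NH:
  assumes "t > 0"
  shows "ddphi phi_NH y t = (1 / t + y\<^sup>2 / t\<^sup>2) * phi_NH y t"
proof -
  have "deriv (\<lambda>w. phi_NH w t) = (\<lambda>z. z / t * phi_NH z t)"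
    using dphi_NH[OF assms] by (auto simp: dphi_def)
  moreover have "((\<lambda>z. z / t * phi_NH z t) has_real_derivative
      (1 / t + y\<^sup>2 / t\<^sup>2) * phi_NH y t) (at y)"
    by (rule DERIV_cong[OF DERIV_mult[OF DERIV_cdivide[OF DERIV_ident] phi_NH_has_derivative[OF assms]]])
      (simp add: power2_eq_square algebra_simps)
  ultimately show ?thesis unfolding ddphi_def by (simp add: DERIV_imp_deriv)
qed

lemma phi_NH_strict_antimono:
  assumes "0 < s" "s < t"
  shows "phi_NH y t < phi_NH y s"
proof -
  have "exp (y\<^sup>2 / (2 * t)) \<le> exp (y\<^sup>2 / (2 * s))"
    using assms by (simp add: frac_le)
  moreover have "1 / sqrt t < 1 / sqrt s"
    using assms by (simp add: frac_less2)
  ultimately have "exp (y\<^sup>2 / (2 * t)) * (1 / sqrt t) < exp (y\<^sup>2 / (2 * s)) * (1 / sqrt s)"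
    using assms by (intro mult_le_less_imp_less) auto
  then show ?thesis using assms by (simp add: phi_NH_eq)
qed

lemma Phi_NH_strict_antimono:
  assumes "N \<ge> 1" "0 < s" "s < t"
  shows "Phi phi_NH N z t < Phi phi_NH N z s"
  unfolding Phi_def using assms
  by (intro sum_strict_mono) (auto simp: phi_NH_strict_antimono lessThan_empty_iff)

lemma Phi_NH_pos: "N \<ge> 1 \<Longrightarrow> t > 0 \<Longrightarrow> Phi phi_NH N z t > 0"
  unfolding Phi_def by (intro sum_pos) (auto simp: phi_NH_pos lessThan_empty_iff)

lemma Phi_NH_mono_abs:
  assumes "t > 0" "\<And>i. i < N \<Longrightarrow> \<bar>z i\<bar> \<le> \<bar>z' i\<bar>"
  shows "Phi phi_NH N z t \<le> Phi phi_NH N z' t"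
  unfolding Phi_def using assms
  by (intro sum_mono) (auto simp: phi_NH_eq intro!: divide_right_mono simp: abs_le_square_iff)

section \<open>Instantaneous regrets and played weights\<close>

lemma sum_prob_inst_regret:
  assumes "prob_simplex N p"
  shows "(\<Sum>i<N. p i * inst_regret N p l i) = 0"
proof -
  have "(\<Sum>i<N. p i * inst_regret N p l i)
      = (\<Sum>i<N. p i) * (\<Sum>k<N. p k * l k) - (\<Sum>i<N. p i * l i)"
    by (simp add: inst_regret_def right_diff_distrib sum_subtractf sum_distrib_right)
  then show ?thesis using assms by (simp add: prob_simplex_def)
qed

lemma abs_inst_regret_le:
  assumes p: "prob_simplex N p" and l: "\<And>k. k < N \<Longrightarrow> \<bar>l k - l i\<bar> \<le> B"
  shows "\<bar>inst_regret N p l i\<bar> \<le> B"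
proof -
  have p1: "(\<Sum>k<N. p k) = 1" and p0: "\<And>k. k < N \<Longrightarrow> 0 \<le> p k"
    using p by (auto simp: prob_simplex_def)
  have "inst_regret N p l i = (\<Sum>k<N. p k * l k) - (\<Sum>k<N. p k) * l i"
    by (simp add: inst_regret_def p1)
  also have "\<dots> = (\<Sum>k<N. p k * (l k - l i))"
    by (simp add: right_diff_distrib sum_subtractf sum_distrib_right)
  finally have "\<bar>inst_regret N p l i\<bar> \<le> (\<Sum>k<N. \<bar>p k * (l k - l i)\<bar>)" by simp
  also have "\<dots> \<le> (\<Sum>k<N. p k * B)"
    using p0 l by (intro sum_mono) (auto simp: abs_mult intro!: mult_left_mono)
  also have "\<dots> = B" by (simp add: sum_distrib_right[symmetric] p1)
  finally show ?thesis .
qed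

text \<open>The instantaneous regret has mean zero under the played distribution, which is a
  positive multiple of \<open>d\<close> unless \<open>d\<close> vanishes on all experts.\<close>

lemma sum_gradient_inst_regret:
  assumes p: "prob_simplex N p"
    and play: "(\<exists>i<N. d i \<noteq> 0) \<longrightarrow> (\<exists>c>0. \<forall>i<N. p i = c * d i)"
  shows "(\<Sum>i<N. d i * inst_regret N p l i) = 0"
proof (cases "\<exists>i<N. d i \<noteq> 0")
  case True
  then obtain c where c: "c > 0" "\<forall>i<N. p i = c * d i" using play by auto
  have "c * (\<Sum>i<N. d i * inst_regret N p l i) = (\<Sum>i<N. p i * inst_regret N p l i)"
    unfolding sum_distrib_left using c by (intro sum.cong) auto
  then show ?thesis using sum_prob_inst_regret[OF p] c by simp
qed auto

text \<open>This guarantees that a time increment \<open>\<ge> 0\<close> can restore the potential.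
  Each summand lies above its tangent, projecting onto the half-line can only help, and the tangent
  terms sum to zero.\<close>

lemma Phi_NH_le_after_update:
  fixes x a :: "nat \<Rightarrow> real"
  assumes t: "t > 0" and orth: "(\<Sum>i<N. dphi phi_NH (max (x i) 0) t * a i) = 0"
  shows "Phi phi_NH N (\<lambda>i. max (x i) 0) t \<le> Phi phi_NH N (\<lambda>i. max (x i + a i) 0) t"
proof -
  have "phi_NH z t + dphi phi_NH z t * b \<le> phi_NH z' t"
    if "z = max y 0" "z' = max (y + b) 0" for y z z' b :: real
  proof -
    \<comment> \<open>For \<open>y \<ge> 0\<close> truncation at zero only increases the step; for
      \<open>y < 0\<close> the slope at \<open>z = 0\<close> vanishes.\<close>
    have "2 * z * b \<le> 2 * z * (z' - z)"
    proof (cases "y \<ge> 0")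
      case True
      then have "b \<le> z' - z" "0 \<le> z" using that by auto
      then show ?thesis by (intro mult_left_mono) auto
    next
      case False
      then show ?thesis using that by simp
    qed
    also have "\<dots> \<le> z'\<^sup>2 - z\<^sup>2"
      using zero_le_power2[of "z' - z"] by (simp add: power2_eq_square algebra_simps)
    finally have "z * b / t \<le> z'\<^sup>2 / (2 * t) - z\<^sup>2 / (2 * t)"
      using t by (simp add: field_simps)
    then have "1 + z * b / t \<le> exp (z'\<^sup>2 / (2 * t) - z\<^sup>2 / (2 * t))"
      using exp_ge_add_one_self[of "z'\<^sup>2 / (2 * t) - z\<^sup>2 / (2 * t)"] by linarith
    then have "exp (z\<^sup>2 / (2 * t)) * (1 + z * b / t)
        \<le> exp (z\<^sup>2 / (2 * t)) * exp (z'\<^sup>2 / (2 * t) - z\<^sup>2 / (2 * t))"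
      by (intro mult_left_mono) auto
    also have "\<dots> = exp (z'\<^sup>2 / (2 * t))" by (simp add: exp_add[symmetric])
    finally have "exp (z\<^sup>2 / (2 * t)) * (1 + z * b / t) / sqrt t \<le> exp (z'\<^sup>2 / (2 * t)) / sqrt t"
      using t by (intro divide_right_mono) auto
    then show ?thesis using t by (simp add: phi_NH_eq dphi_NH algebra_simps add_divide_distrib)
  qed
  then have "(\<Sum>i<N. phi_NH (max (x i) 0) t + dphi phi_NH (max (x i) 0) t * a i)
      \<le> (\<Sum>i<N. phi_NH (max (x i + a i) 0) t)"
    by (intro sum_mono) blast
  then show ?thesis using orth by (simp add: Phi_def sum.distrib)
qed

text \<open>Intermediate value theorem. Exponents shrink as time grows, so the potential at
  \<open>s \<ge> t\<close> is at most \<open>C / sqrt s\<close>, which drops to \<open>c\<close>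
  once \<open>s \<ge> (C / c)\<^sup>2\<close>.\<close>

lemma Phi_NH_attains:
  assumes N: "N \<ge> 1" and t: "t > 0" and c: "0 < c" "c \<le> Phi phi_NH N z t"
  shows "\<exists>s\<ge>t. Phi phi_NH N z s = c"
proof -
  define C where "C = (\<Sum>i<N. exp ((z i)\<^sup>2 / (2 * t)))"
  have C0: "0 \<le> C" by (simp add: C_def sum_nonneg)
  define s where "s = max t ((C / c)\<^sup>2)"
  have s: "t \<le> s" "s > 0" using t by (auto simp: s_def)
  have "sqrt ((C / c)\<^sup>2) \<le> sqrt s" by (intro real_sqrt_le_mono) (simp add: s_def)
  then have Cs: "C / c \<le> sqrt s" using C0 c by simp
  have "Phi phi_NH N z s \<le> (\<Sum>i<N. exp ((z i)\<^sup>2 / (2 * t)) / sqrt s)"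
    unfolding Phi_def using s t
    by (intro sum_mono) (auto simp: phi_NH_eq intro!: divide_right_mono divide_left_mono)
  also have "\<dots> = C / sqrt s" by (simp add: C_def sum_divide_distrib)
  also have "\<dots> \<le> c" using Cs s c by (simp add: field_simps)
  finally have low: "Phi phi_NH N z s \<le> c" .
  have "continuous_on {t..s} (\<lambda>r. \<Sum>i<N. exp ((z i)\<^sup>2 / (2 * r)) / sqrt r)"
    using t by (intro continuous_intros) auto
  then have cont: "continuous_on {t..s} (Phi phi_NH N z)"
    using t by (subst continuous_on_cong[OF refl]) (auto simp: Phi_def phi_NH_eq)
  show ?thesis using IVT2'[OF low c(2) s(1) cont] by blast
qed

lemma cp_run_NH_exists:
  assumes N: "N \<ge> 1" and t0: "t0 > 0"
  shows "\<exists>p x t V. cp_run phi_NH {0..} N t0 l p x t V"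
proof -
  \<comment> \<open>The run is built by dependent choice on states \<open>(p, x, t, V)\<close>. The
    invariant is \<open>t > 0\<close>, on which the derivative formulas and the choice of the next
    time rest.\<close>
  define pst :: "nat \<Rightarrow> (nat \<Rightarrow> real) \<times> (nat \<Rightarrow> real) \<times> real \<times> real \<Rightarrow> bool"
    where "pst n st \<longleftrightarrow> (case st of (p, x, t, V) \<Rightarrow>
      t > 0 \<and> (n = 0 \<longrightarrow> x = (\<lambda>_. 0) \<and> t = t0 \<and> V = 0))" for n st
  define stp :: "nat \<Rightarrow> (nat \<Rightarrow> real) \<times> (nat \<Rightarrow> real) \<times> real \<times> real
      \<Rightarrow> (nat \<Rightarrow> real) \<times> (nat \<Rightarrow> real) \<times> real \<times> real \<Rightarrow> bool"
    where "stp n st st' \<longleftrightarrow> (case st of (_, x, t, V) \<Rightarrow> case st' of (p', x', t', V') \<Rightarrow>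
        prob_simplex N p' \<and>
        ((\<exists>i<N. dphi phi_NH (proj {0..} (x i)) t \<noteq> 0) \<longrightarrow>
           (\<exists>c>0. \<forall>i<N. p' i = c * dphi phi_NH (proj {0..} (x i)) t)) \<and>
        (\<forall>i<N. x' i = x i + inst_regret N p' (l (Suc n)) i) \<and>
        t \<le> t' \<and>
        Phi phi_NH N (\<lambda>i. proj {0..} (x' i)) t' = Phi phi_NH N (\<lambda>i. proj {0..} (x i)) t \<and>
        V' = V + (\<Sum>i<N. (ddphi phi_NH (proj {0..} (x i)) t
                     / (\<Sum>k<N. ddphi phi_NH (proj {0..} (x k)) t))
                   * (inst_regret N p' (l (Suc n)) i)\<^sup>2))" for n st st'
  have "\<exists>f. \<forall>n. pst n (f n) \<and> stp n (f n) (f (Suc n))"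
  proof (rule dependent_nat_choice)
    show "\<exists>st. pst 0 st" using t0 by (intro exI[of _ "(\<lambda>_. 0, \<lambda>_. 0, t0, 0)"]) (simp add: pst_def)
  next
    fix st n assume "pst n st"
    then obtain p x t V where st: "st = (p, x, t, V)" and t: "t > 0"
      by (cases st) (auto simp: pst_def)
    define d where "d i = dphi phi_NH (max (x i) 0) t" for i
    have d0: "0 \<le> d i" for i
      using t phi_NH_pos[OF t, of "max (x i) 0"] by (simp add: d_def dphi_NH less_imp_le)
    define D where "D = (\<Sum>i<N. d i)"
    \<comment> \<open>The uniform distribution is the default when all derivatives vanish, as
      happens at the start, where all regrets are zero.\<close>
    define p' where "p' i = (if \<exists>i<N. d i \<noteq> 0 then d i / D else 1 / real N)" for i
    have D0: "D > 0" if "\<exists>i<N. d i \<noteq> 0"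
    proof -
      obtain i where "i < N" "d i \<noteq> 0" using \<open>\<exists>i<N. d i \<noteq> 0\<close> by blast
      then show ?thesis unfolding D_def using d0 by (intro sum_pos2[of _ i]) (auto simp: less_le)
    qed
    have simplex: "prob_simplex N p'"
    proof (cases "\<exists>i<N. d i \<noteq> 0")
      case True
      have "p' = (\<lambda>i. d i / D)" by (rule ext) (simp only: p'_def if_P[OF True])
      then show ?thesis using D0[OF True] d0
        by (simp add: prob_simplex_def sum_divide_distrib[symmetric] D_def[symmetric])
    next
      case False
      have "p' = (\<lambda>i. 1 / real N)" by (rule ext) (simp only: p'_def if_not_P[OF False])
      then show ?thesis using N by (simp add: prob_simplex_def)
    qed
    have play: "(\<exists>i<N. d i \<noteq> 0) \<longrightarrow> (\<exists>c>0. \<forall>i<N. p' i = c * d i)"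
    proof
      assume ex: "\<exists>i<N. d i \<noteq> 0"
      show "\<exists>c>0. \<forall>i<N. p' i = c * d i"
        using D0[OF ex] ex by (intro exI[of _ "1 / D"]) (simp add: p'_def)
    qed
    define x' where "x' i = x i + inst_regret N p' (l (Suc n)) i" for i
    have "(\<Sum>i<N. dphi phi_NH (max (x i) 0) t * inst_regret N p' (l (Suc n)) i) = 0"
      using sum_gradient_inst_regret[OF simplex play] by (simp add: d_def)
    then have "Phi phi_NH N (\<lambda>i. max (x i) 0) t \<le> Phi phi_NH N (\<lambda>i. max (x' i) 0) t"
      unfolding x'_def using Phi_NH_le_after_update[OF t] by simp
    then obtain t' where t': "t \<le> t'"
      "Phi phi_NH N (\<lambda>i. max (x' i) 0) t' = Phi phi_NH N (\<lambda>i. max (x i) 0) t"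
      using Phi_NH_attains[OF N t Phi_NH_pos[OF N t]] by blast
    show "\<exists>st'. pst (Suc n) st' \<and> stp n st st'"
      unfolding st pst_def stp_def
      using t t' simplex play
      by (intro exI[of _ "(p', x', t', V + (\<Sum>i<N. (ddphi phi_NH (proj {0..} (x i)) t
                     / (\<Sum>k<N. ddphi phi_NH (proj {0..} (x k)) t))
                   * (inst_regret N p' (l (Suc n)) i)\<^sup>2))"]) (simp add: proj_nonneg x'_def d_def)
  qed
  then obtain f where f: "\<And>n. pst n (f n)" "\<And>n. stp n (f n) (f (Suc n))" by blast
  define p where "p j = fst (f j)" for j
  define x where "x j = fst (snd (f j))" for j
  define t where "t j = fst (snd (snd (f j)))" for j
  define V where "V j = snd (snd (snd (f j)))" for j
  have "cp_run phi_NH {0..} N t0 l p x t V"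
    unfolding cp_run_def
  proof (intro conjI, goal_cases)
    case 1 then show ?case using f(1)[of 0] by (auto simp: pst_def x_def split: prod.splits)
  next
    case 2 then show ?case using f(1)[of 0] by (auto simp: pst_def t_def split: prod.splits)
  next
    case 3 then show ?case using f(1)[of 0] by (auto simp: pst_def V_def split: prod.splits)
  next
    case 4
    show ?case
    proof (intro allI impI, goal_cases)
      case (1 j)
      then obtain n where n: "j = Suc n" by (cases j) auto
      show ?case using f(2)[of n] unfolding n stp_def
        by (simp add: case_prod_beta p_def x_def t_def V_def)
    qed
  qed
  then show ?thesis by blast
qed

section \<open>Order statistics as counts of coordinates\<close>

lemma card_ge_kth_largest:
  assumes "1 \<le> k" "k \<le> N"
  shows "k \<le> card {i. i < N \<and> kth_largest N k x \<le> x i}"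
proof -
  define xs where "xs = map x [0..<N]"
  define ys where "ys = rev (sort xs)"
  define X where "X = kth_largest N k x"
  have X: "X = ys ! (k - 1)" by (simp add: X_def kth_largest_def ys_def xs_def)
  have len: "length ys = N" by (simp add: ys_def xs_def)
  have srt: "sorted_wrt (\<ge>) ys" by (simp add: ys_def sorted_wrt_rev)
  have ge: "X \<le> y" if y: "y \<in> set (take k ys)" for y
  proof -
    obtain i where "i < length (take k ys)" "take k ys ! i = y"
      using y unfolding in_set_conv_nth by blast
    then have i: "i < k" "y = ys ! i" by auto
    show ?thesis
    proof (cases "i = k - 1")
      case False
      then show ?thesis using i assms len sorted_wrt_nth_less[OF srt, of i "k - 1"] by (simp add: X)
    qed (simp add: i X)
  qed
  have "k = length (filter (\<lambda>y. X \<le> y) (take k ys))" using ge assms len by (simp add: filter_True)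
  also have "\<dots> \<le> length (filter (\<lambda>y. X \<le> y) (take k ys @ drop k ys))"
    by (simp only: filter_append length_append)
  \<comment> \<open>Passing through multisets undoes the sorting while keeping multiplicities, so
    equal values are counted as distinct indices.\<close>
  also have "\<dots> = size (filter_mset (\<lambda>y. X \<le> y) (mset ys))" by (simp flip: mset_filter)
  also have "mset ys = mset xs" by (simp add: ys_def)
  also have "size (filter_mset (\<lambda>y. X \<le> y) (mset xs)) = length (filter (\<lambda>y. X \<le> y) xs)"
    by (simp flip: mset_filter)
  also have "\<dots> = length (filter (\<lambda>i. X \<le> x i) [0..<N])"
    by (simp add: xs_def filter_map comp_def)
  also have "\<dots> = card {i. i < N \<and> X \<le> x i}"
    by (simp add: distinct_length_filter Int_def conj_commute)
  finally show ?thesis by (simp add: X_def)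
qed

section \<open>From elapsed time to the regret bound\<close>

text \<open>Reduces a logarithmic inequality to a polynomial one:
  \<open>ln (A / m) \<le> A / m - 1\<close> handles the left side, and the surplus
  \<open>(m - u) * ln m\<close> is bounded below through \<open>c\<close>. In the application
  \<open>u = t / t0\<close>, \<open>m\<close> is a lower bound for \<open>(t0 + 2 * V) / t0\<close>,
  and \<open>d\<close> comes from the rounding of the quantile.\<close>

lemma ln_comparison:
  fixes u m A c d :: real
  assumes "0 < A" "0 \<le> u" "u \<le> m" "0 < m" "c \<le> ln m"
    and "u * (A - m) \<le> (m - u) * ((c + d) * m)"
  shows "u * ln A \<le> m * ln m + d * (m - u)"
proof -
  have "ln (A / m) \<le> A / m - 1" using assms by (intro ln_le_minus_one) auto
  then have "ln A - ln m \<le> (A - m) / m" using assms by (simp add: ln_div diff_divide_distrib)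
  then have "u * (ln A - ln m) \<le> u * ((A - m) / m)" using assms by (intro mult_left_mono)
  also have "\<dots> \<le> (m - u) * (c + d)"
    using assms by (simp add: divide_le_eq mult.assoc)
  also have "\<dots> \<le> (m - u) * (ln m + d)" using assms by (intro mult_left_mono) auto
  finally show ?thesis by (simp add: algebra_simps)
qed

text \<open>The choice \<open>c = 1 - 1 / m\<close>, which is sharp to first order at
  \<open>m = 1\<close>.\<close>

lemma ln_comparison':
  fixes u m A d :: real
  assumes "0 < A" "0 \<le> u" "u \<le> m" "1 \<le> m"
    and "u * (A - m) \<le> (m - u) * (m - 1 + d * m)"
  shows "u * ln A \<le> m * ln m + d * (m - u)"
proof (rule ln_comparison)
  show "1 - 1 / m \<le> ln m"
    using ln_le_minus_one[of "1 / m"] assms by (simp add: ln_div)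
  have "(1 - 1 / m + d) * m = m - 1 + d * m" using assms by (simp add: field_simps)
  then show "u * (A - m) \<le> (m - u) * ((1 - 1 / m + d) * m)" using assms by simp
qed (use assms in auto)

text \<open>The case \<open>k \<ge> 2\<close>. After substituting \<open>q = 1 + e\<close>, all
  coefficients of the polynomial gap are nonnegative.\<close>

lemma scalar_bound_many:
  fixes q m :: real
  assumes q: "1 \<le> q" and m: "m = 1 + 19/10 * (q\<^sup>2 - 1)"
  shows "q\<^sup>2 * ln ((3/2 * q - 1/2)\<^sup>2) \<le> m * ln m"
proof -
  define e where "e = q - 1"
  have e: "0 \<le> e" "q = 1 + e" using q by (auto simp: e_def)
  have q2: "1 \<le> q\<^sup>2" using q by simp
  have mm: "1 \<le> m" "q\<^sup>2 \<le> m" unfolding m using q2 by argo+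
  have "(m - q\<^sup>2) * (m - 1 + 0 * m) - q\<^sup>2 * ((3/2 * q - 1/2)\<^sup>2 - m)
      = 4/5 * e + 809/100 * e^2 + 347/50 * e^3 + 34/25 * e^4"
    unfolding m e(2) by (simp add: eval_nat_numeral field_simps)
  also have "\<dots> \<ge> 0" using e by (intro add_nonneg_nonneg mult_nonneg_nonneg zero_le_power) auto
  finally have "q\<^sup>2 * ((3/2 * q - 1/2)\<^sup>2 - m) \<le> (m - q\<^sup>2) * (m - 1 + 0 * m)" by (simp only: diff_ge_0_iff_ge)
  from ln_comparison'[OF _ _ mm(2,1) this] show ?thesis using q by simp
qed

text \<open>The case \<open>k = 1\<close>, \<open>N \<ge> 3\<close>. The surplus \<open>4/5\<close>
  is a lower bound for \<open>2 * ln (N / 2)\<close>; without it the inequality would be too tight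
  near \<open>q = 1\<close>.\<close>

lemma scalar_bound_three:
  fixes q m :: real
  assumes q: "1 \<le> q" and m: "m = 1 + 19/10 * (q\<^sup>2 - 1)"
  shows "q\<^sup>2 * ln ((2 * q - 4/3)\<^sup>2) \<le> m * ln m + 4/5 * (m - q\<^sup>2)"
proof -
  define e where "e = q - 1"
  have e: "0 \<le> e" "q = 1 + e" using q by (auto simp: e_def)
  have q2: "1 \<le> q\<^sup>2" using q by simp
  have mm: "1 \<le> m" "q\<^sup>2 \<le> m" unfolding m using q2 by argo+
  have "(m - q\<^sup>2) * (m - 1 + 4/5 * m) - q\<^sup>2 * ((2 * q - 4/3)\<^sup>2 - m)
      = 5/9 + 829/225 * e + 30947/2250 * e^2 + 3467/375 * e^3 + 489/500 * e^4"
    unfolding m e(2) by (simp add: eval_nat_numeral field_simps)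
  also have "\<dots> \<ge> 0" using e by (intro add_nonneg_nonneg mult_nonneg_nonneg zero_le_power) auto
  finally have "q\<^sup>2 * ((2 * q - 4/3)\<^sup>2 - m) \<le> (m - q\<^sup>2) * (m - 1 + 4/5 * m)" by (simp only: diff_ge_0_iff_ge)
  from ln_comparison'[OF _ _ mm(2,1) this] show ?thesis using q by simp
qed

text \<open>The case \<open>N = 2\<close> away from \<open>q = 1\<close>. The gap has a negative
  linear coefficient in \<open>e\<close>, which \<open>e \<ge> 1/20\<close> compensates. Its quartic
  coefficient is negative as well, so for \<open>e > 6\<close> the cruder but larger bound
  \<open>ln m \<ge> 2\<close> takes over.\<close>

lemma scalar_bound_two_late:
  fixes q m :: real
  assumes q: "21/20 \<le> q" and m: "m = 1 + 19/10 * (q\<^sup>2 - 1)"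
  shows "q\<^sup>2 * ln ((2 * q - 1)\<^sup>2) \<le> m * ln m"
proof -
  define e where "e = q - 1"
  have e: "1/20 \<le> e" "q = 1 + e" using q by (auto simp: e_def)
  have q2: "1 \<le> q\<^sup>2" using q by simp
  have mm: "1 \<le> m" "q\<^sup>2 \<le> m" unfolding m using q2 by argo+
  show ?thesis
  proof (cases "e \<le> 6")
    case True
    have "(m - q\<^sup>2) * (m - 1 + 0 * m) - q\<^sup>2 * ((2 * q - 1)\<^sup>2 - m)
        = e * (217/50 * e - 1/5 + e^2 * (61/25 - 39/100 * e))"
      unfolding m e(2) by (simp add: eval_nat_numeral field_simps)
    also have "\<dots> \<ge> 0" using e True by (intro add_nonneg_nonneg mult_nonneg_nonneg zero_le_power) auto
    finally have "q\<^sup>2 * ((2 * q - 1)\<^sup>2 - m) \<le> (m - q\<^sup>2) * (m - 1 + 0 * m)" by (simp only: diff_ge_0_iff_ge)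
    from ln_comparison'[OF _ _ mm(2,1) this] show ?thesis using q by simp
  next
    case False
    have "exp 2 = exp 1 * exp (1::real)" by (simp add: exp_add[symmetric])
    also have "\<dots> \<le> 3 * 3" using exp_le by (intro mult_mono) auto
    finally have "exp 2 \<le> (9::real)" by simp
    also have "9 \<le> m"
    proof -
      have "7\<^sup>2 \<le> q\<^sup>2" using False e by (intro power_mono) auto
      then show ?thesis by (simp add: m)
    qed
    finally have ln: "2 \<le> ln m" by (metis exp_gt_zero exp_le_cancel_iff exp_ln less_le_trans)
    have "(m - q\<^sup>2) * ((2 + 0) * m) - q\<^sup>2 * ((2 * q - 1)\<^sup>2 - m)
        = 17/5 * e + 649/50 * e^2 + 232/25 * e^3 + 33/25 * e^4"
      unfolding m e(2) by (simp add: eval_nat_numeral field_simps)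
    also have "\<dots> \<ge> 0" using e by (intro add_nonneg_nonneg mult_nonneg_nonneg zero_le_power) auto
    finally have "q\<^sup>2 * ((2 * q - 1)\<^sup>2 - m) \<le> (m - q\<^sup>2) * ((2 + 0) * m)" by (simp only: diff_ge_0_iff_ge)
    from ln_comparison[OF _ _ mm(2) _ ln this] show ?thesis using q mm(1) by simp
  qed
qed

text \<open>The case \<open>N = 2\<close> near \<open>q = 1\<close>, with \<open>m\<close> obtained
  from \<open>t - t0 \<le> q * V\<close>. Now the linear term of the gap cancels exactly and the
  quadratic coefficient is positive; the nested bounds use \<open>e \<le> 1/20\<close>.\<close>

lemma scalar_bound_two_early:
  fixes q m :: real
  assumes q: "1 \<le> q" "q \<le> 21/20" and m: "m = 1 + 2 * (q\<^sup>2 - 1) / q"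
  shows "q\<^sup>2 * ln ((2 * q - 1)\<^sup>2) \<le> m * ln m"
proof -
  define e where "e = q - 1"
  have e: "0 \<le> e" "e \<le> 1/20" "q = 1 + e" using q by (auto simp: e_def)
  have q2: "1 \<le> q\<^sup>2" using q by simp
  have m1: "m - 1 = 2 * (e * (2 + e)) / q" unfolding m e(3) by (simp add: power2_eq_square algebra_simps)
  have mu: "m - q\<^sup>2 = e * (2 + e) * (1 - e) / q"
    unfolding m e(3) using e by (simp add: power2_eq_square field_simps)
  have Am: "(2 * q - 1)\<^sup>2 - m = e\<^sup>2 * (6 + 4 * e) / q"
    unfolding m e(3) using e by (simp add: power2_eq_square field_simps)
  have "(m - q\<^sup>2) * (m - 1 + 0 * m) - q\<^sup>2 * ((2 * q - 1)\<^sup>2 - m)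
      = e\<^sup>2 / q\<^sup>2 * (2 * (2 + e)\<^sup>2 * (1 - e) - q ^ 3 * (6 + 4 * e))"
    unfolding m1 mu Am using q by (simp add: eval_nat_numeral field_simps)
  also have "2 * (2 + e)\<^sup>2 * (1 - e) - q ^ 3 * (6 + 4 * e)
      = 2 - e * (22 + e * (36 + e * (20 + 4 * e)))"
    unfolding e(3) by (simp add: eval_nat_numeral algebra_simps)
  also have "0 \<le> e\<^sup>2 / q\<^sup>2 * (2 - e * (22 + e * (36 + e * (20 + 4 * e))))"
  proof -
    have 1: "e * (20 + 4 * e) \<le> 1/20 * (20 + 4)" using e by (intro mult_mono) auto
    have 2: "e * (36 + e * (20 + 4 * e)) \<le> 1/20 * (36 + 2)" using e 1 by (intro mult_mono) auto
    have 3: "e * (22 + e * (36 + e * (20 + 4 * e))) \<le> 1/20 * (22 + 2)" using e 2 by (intro mult_mono) auto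
    show ?thesis using 3 by (intro mult_nonneg_nonneg) auto
  qed
  finally have *: "q\<^sup>2 * ((2 * q - 1)\<^sup>2 - m) \<le> (m - q\<^sup>2) * (m - 1 + 0 * m)" by (simp only: diff_ge_0_iff_ge)
  have "1 \<le> m" using q q2 by (simp add: m)
  moreover have "0 \<le> m - q\<^sup>2" unfolding mu using e q by simp
  ultimately show ?thesis using ln_comparison'[OF _ _ _ _ *] q by simp
qed

text \<open>Everything is scaled by \<open>t0\<close>: \<open>q\<^sup>2\<close> is the relative time
  and \<open>m\<close> the relative size of \<open>t0 + 2 * V\<close>. Solving \<open>pot\<close>
  for the exponential gives \<open>X\<^sup>2 \<le> 2 * t * ln Z\<close>, and the rest compares
  \<open>ln Z\<close> with \<open>ln m\<close> and \<open>ln L\<close>, where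
  \<open>L \<le> 1 / eps\<close>.\<close>

lemma regret_bound_of_time:
  fixes X t t0 V eps :: real and N k :: nat
  assumes k: "1 \<le> k" "k < N" and eps: "0 < eps" "eps \<le> (real k + 1) / real N"
    and t: "1 \<le> t0" "t0 \<le> t"
    and pot: "real k * exp (X\<^sup>2 / (2 * t)) + (real N - real k) \<le> real N * sqrt (t / t0)"
    and tV: "t - t0 \<le> 21/20 * V"
    and two: "N = 2 \<Longrightarrow> sqrt (t / t0) \<le> 21/20 \<Longrightarrow> t - t0 \<le> sqrt (t / t0) * V"
  shows "X \<le> sqrt ((t0 + 2 * V) * (ln (t0 + 2 * V) + 2 * ln (1 / eps)))"
proof -
  define q where "q = sqrt (t / t0)"
  have q1: "1 \<le> q" using t by (simp add: q_def)
  have q2: "q\<^sup>2 = t / t0" using t by (simp add: q_def)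
  then have tq: "t = t0 * q\<^sup>2" using t by simp
  define L where "L = real N / (real k + 1)"
  have L1: "1 \<le> L" using k by (simp add: L_def)
  define m where "m = 1 + 2 * V / t0"
  have V0: "0 \<le> V" using tV t by simp
  have m1: "1 \<le> m" using V0 t by (simp add: m_def)
  have M: "t0 + 2 * V = t0 * m" using t by (simp add: m_def distrib_left)
  have m19: "1 + 19/10 * (q\<^sup>2 - 1) \<le> m"
  proof -
    \<comment> \<open>The constant \<open>19/10\<close> is below
      \<open>2 / (21/20) = 40/21\<close>.\<close>
    have "19/10 * (t - t0) \<le> 2 * V" using tV V0 by simp
    then have "19/10 * (t - t0) / t0 \<le> 2 * V / t0" using t by (intro divide_right_mono) auto
    moreover have "19/10 * (q\<^sup>2 - 1) = 19/10 * (t - t0) / t0" using t by (simp add: q2 diff_divide_distrib)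
    ultimately have "19/10 * (q\<^sup>2 - 1) \<le> 2 * V / t0" by (simp only:)
    then show ?thesis unfolding m_def by (rule add_left_mono)
  qed
  have qq: "1 \<le> q\<^sup>2" using q1 by simp
  have mq: "q\<^sup>2 \<le> m" using m19 qq by argo
  have mono: "m' * ln m' \<le> m * ln m" if "1 \<le> m'" "m' \<le> m" for m'
    using that by (intro mult_mono) auto
  define Z where "Z = 1 + real N / real k * (q - 1)"
  have Z: "exp (X\<^sup>2 / (2 * t)) \<le> Z"
    using pot k by (simp add: Z_def q_def[symmetric] field_simps)
  have main: "q\<^sup>2 * (2 * ln Z) \<le> m * (ln m + 2 * ln L)"
  proof -
    \<comment> \<open>Factoring \<open>L\<close> out of \<open>Z\<close> leaves \<open>Z0\<close>,
      which depends on \<open>q\<close> alone. As \<open>ln L\<close> is multiplied by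
      \<open>q\<^sup>2\<close> on the left and by \<open>m\<close> on the right, the difference is
      available as surplus.\<close>
    have key: ?thesis if Z0: "Z \<le> L * Z0" "0 < Z0"
      and b: "q\<^sup>2 * ln (Z0\<^sup>2) \<le> m * ln m + 2 * (m - q\<^sup>2) * ln L" for Z0
    proof -
      have "0 < Z" using less_le_trans[OF exp_gt_zero Z] .
      then have "ln Z \<le> ln (L * Z0)" using Z0 L1 by simp
      also have "\<dots> = ln L + ln Z0" using Z0 L1 by (simp add: ln_mult)
      finally have "q\<^sup>2 * (2 * ln Z) \<le> q\<^sup>2 * (2 * (ln L + ln Z0))" by (intro mult_left_mono) auto
      also have "\<dots> = 2 * q\<^sup>2 * ln L + q\<^sup>2 * ln (Z0\<^sup>2)" using Z0 by (simp add: ln_realpow algebra_simps)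
      also have "\<dots> \<le> m * (ln m + 2 * ln L)" using b by (simp add: algebra_simps)
      finally show ?thesis .
    qed
    have lnL: "0 \<le> 2 * (m - q\<^sup>2) * ln L" using L1 mq by simp
    define m' where "m' = 1 + 19/10 * (q\<^sup>2 - 1)"
    have m': "1 \<le> m'" "m' \<le> m" using m19 qq by (auto simp: m'_def)
    \<comment> \<open>The loss is the ratio \<open>(k + 1) / k\<close> of \<open>N / k\<close> to
      \<open>L\<close>: at most \<open>3/2\<close> for \<open>k \<ge> 2\<close>, but
      \<open>2\<close> for \<open>k = 1\<close>. In the latter case \<open>L \<ge> 3/2\<close> helps
      for \<open>N \<ge> 3\<close>, whereas \<open>N = 2\<close> gives \<open>L = 1\<close> and no
      surplus.\<close>
    consider "2 \<le> k" | "k = 1" "3 \<le> N" | "k = 1" "N = 2" using k by linarith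
    then show ?thesis
    proof cases
      case 1
      have "real N / real k \<le> 3/2 * L"
      proof -
        have "real N * (2 * (real k + 1)) \<le> real N * (3 * real k)" using 1 by (intro mult_left_mono) auto
        then show ?thesis using 1 by (simp add: L_def field_simps)
      qed
      then have "real N / real k * (q - 1) \<le> 3/2 * L * (q - 1)" using q1 by (intro mult_right_mono) auto
      then have "Z \<le> L * (3/2 * q - 1/2)" using L1 by (simp add: Z_def algebra_simps)
      moreover have "q\<^sup>2 * ln ((3/2 * q - 1/2)\<^sup>2) \<le> m * ln m + 2 * (m - q\<^sup>2) * ln L"
        using scalar_bound_many[OF q1 m'_def] mono[OF m'] lnL by linarith
      ultimately show ?thesis using q1 by (intro key) auto
    next
      case 2
      have L: "L = real N / 2" "3/2 \<le> L" using 2 by (auto simp: L_def)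
      have "Z = 1 + 2 * (L * q) - 2 * L" using 2 by (simp add: Z_def L(1) algebra_simps)
      moreover have "L * (2 * q - 4/3) = 2 * (L * q) - 4/3 * L" by (simp add: algebra_simps)
      ultimately have "Z \<le> L * (2 * q - 4/3)" using L(2) by linarith
      moreover have "q\<^sup>2 * ln ((2 * q - 4/3)\<^sup>2) \<le> m * ln m + 2 * (m - q\<^sup>2) * ln L"
      proof -
        have "2/5 \<le> ln (3/2 :: real)"
          using ln_approx_bounds[of "3/2" 1] by simp
        also have "\<dots> \<le> ln L" using L by simp
        finally have "2/5 \<le> ln L" .
        moreover have "q\<^sup>2 \<le> m'" unfolding m'_def using qq by argo
        ultimately have "2 * (m' - q\<^sup>2) * (2/5) \<le> 2 * (m - q\<^sup>2) * ln L"
          using m' by (intro mult_mono) auto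
        then show ?thesis using scalar_bound_three[OF q1 m'_def] mono[OF m'] by linarith
      qed
      ultimately show ?thesis using q1 by (intro key) auto
    next
      case 3
      have L: "L = 1" using 3 by (simp add: L_def)
      then have Zb: "Z \<le> L * (2 * q - 1)" using 3 by (simp add: Z_def)
      have "q\<^sup>2 * ln ((2 * q - 1)\<^sup>2) \<le> m * ln m"
      proof (cases "q \<le> 21/20")
        case True
        define m2 where "m2 = 1 + 2 * (q\<^sup>2 - 1) / q"
        have "t - t0 \<le> q * V" using two 3 True by (simp add: q_def)
        then have "t0 * (q\<^sup>2 - 1) \<le> q * V" by (simp add: tq algebra_simps)
        then have "m2 \<le> m" using q1 t by (simp add: m2_def m_def field_simps)
        moreover have "1 \<le> m2" using q1 qq by (simp add: m2_def)
        ultimately show ?thesis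
          using scalar_bound_two_early[OF q1 True m2_def] mono[of m2] by linarith
      next
        case False
        then show ?thesis using scalar_bound_two_late[OF _ m'_def] mono[OF m'] by linarith
      qed
      then show ?thesis using Zb q1 lnL by (intro key) auto
    qed
  qed
  have "X\<^sup>2 / (2 * t) \<le> ln Z"
    using Z by (metis exp_gt_zero exp_le_cancel_iff exp_ln less_le_trans)
  then have "X\<^sup>2 \<le> ln Z * (2 * t)" using t by (simp add: pos_divide_le_eq)
  also have "\<dots> = t0 * (q\<^sup>2 * (2 * ln Z))" by (simp add: tq)
  also have "\<dots> \<le> t0 * (m * (ln m + 2 * ln L))" using main t by (intro mult_left_mono) auto
  also have "\<dots> \<le> (t0 * m) * (ln (t0 * m) + 2 * ln (1 / eps))"
  proof -
    \<comment> \<open>Undoing the scaling only increases the logarithm, by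
      \<open>t0 \<ge> 1\<close>.\<close>
    have "ln m \<le> ln (t0 * m)" using t m1 by (simp add: ln_mult)
    moreover have "ln L \<le> ln (1 / eps)"
    proof -
      have "L \<le> 1 / eps" using eps k by (simp add: L_def field_simps)
      then show ?thesis using L1 by (intro ln_mono) auto
    qed
    ultimately have "ln m + 2 * ln L \<le> ln (t0 * m) + 2 * ln (1 / eps)" by linarith
    then have "t0 * m * (ln m + 2 * ln L) \<le> t0 * m * (ln (t0 * m) + 2 * ln (1 / eps))"
      using t m1 by (intro mult_left_mono) auto
    then show ?thesis by (simp add: mult.assoc)
  qed
  finally show ?thesis unfolding M by (rule real_le_rsqrt)
qed

section \<open>Analysis of a run\<close>

text \<open>A single expert is excluded: there \<open>ln (real N) = 0\<close>, and
  \<open>t0_ge\<close> would give no control of \<open>B\<^sup>2 / t0\<close>.\<close>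

locale NH_run =
  fixes N :: nat and B t0 :: real and l p x :: "nat \<Rightarrow> nat \<Rightarrow> real" and t V :: "nat \<Rightarrow> real"
  assumes run: "cp_run phi_NH {0..} N t0 l p x t V"
    and N2: "N \<ge> 2"
    and t0_ge: "1 \<le> t0" "512 * (exp 1)\<^sup>2 * B\<^sup>2 * ln (real N) \<le> t0"
    and losses: "\<And>j i k. 1 \<le> j \<Longrightarrow> i < N \<Longrightarrow> k < N \<Longrightarrow> \<bar>l j i - l j k\<bar> \<le> B"
begin

text \<open>Regrets and increments are measured in units of \<open>sqrt (t j)\<close>.\<close>

definition y where "y j i = max (x j i) 0 / sqrt (t j)"
definition w where "w j i = exp ((y j i)\<^sup>2 / 2)"
definition al where "al j i = inst_regret N (p (Suc j)) (l (Suc j)) i / sqrt (t j)"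
text \<open>Up to the common factor \<open>t j * sqrt (t j)\<close>, the summands of
  \<open>Q\<close> are the second derivatives of the potential. Hence \<open>A j / Q j\<close> is
  the averaged squared increment, in units of \<open>t j\<close>.\<close>

definition Q where "Q j = (\<Sum>i<N. w j i * (1 + (y j i)\<^sup>2))"
definition A where "A j = (\<Sum>i<N. w j i * (1 + (y j i)\<^sup>2) * (al j i)\<^sup>2)"

section \<open>The run in normalised coordinates\<close>

lemma init: "i < N \<Longrightarrow> x 0 i = 0" "t 0 = t0" "V 0 = 0"
  using run by (auto simp: cp_run_def)

lemma round:
  shows simplex: "prob_simplex N (p (Suc j))"
    and play: "(\<exists>i<N. dphi phi_NH (max (x j i) 0) (t j) \<noteq> 0) \<longrightarrow>
           (\<exists>c>0. \<forall>i<N. p (Suc j) i = c * dphi phi_NH (max (x j i) 0) (t j))"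
    and x_Suc: "i < N \<Longrightarrow> x (Suc j) i = x j i + inst_regret N (p (Suc j)) (l (Suc j)) i"
    and t_le_Suc: "t j \<le> t (Suc j)"
    and Phi_Suc: "Phi phi_NH N (\<lambda>i. max (x (Suc j) i) 0) (t (Suc j)) = Phi phi_NH N (\<lambda>i. max (x j i) 0) (t j)"
    and V_Suc: "V (Suc j) = V j + (\<Sum>i<N. (ddphi phi_NH (max (x j i) 0) (t j)
                     / (\<Sum>k<N. ddphi phi_NH (max (x j k) 0) (t j)))
                   * (inst_regret N (p (Suc j)) (l (Suc j)) i)\<^sup>2)"
proof -
  have R: "\<forall>j\<ge>1.
        prob_simplex N (p j) \<and>
        ((\<exists>i<N. dphi phi_NH (max (x (j-1) i) 0) (t (j-1)) \<noteq> 0) \<longrightarrow>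
           (\<exists>c>0. \<forall>i<N. p j i = c * dphi phi_NH (max (x (j-1) i) 0) (t (j-1)))) \<and>
        (\<forall>i<N. x j i = x (j-1) i + inst_regret N (p j) (l j) i) \<and>
        t (j-1) \<le> t j \<and>
        Phi phi_NH N (\<lambda>i. max (x j i) 0) (t j) = Phi phi_NH N (\<lambda>i. max (x (j-1) i) 0) (t (j-1)) \<and>
        V j = V (j-1) +
          (\<Sum>i<N. (ddphi phi_NH (max (x (j-1) i) 0) (t (j-1))
                     / (\<Sum>k<N. ddphi phi_NH (max (x (j-1) k) 0) (t (j-1))))
                   * (inst_regret N (p j) (l j) i)\<^sup>2)"
    using run unfolding cp_run_def proj_nonneg by blast
  have "1 \<le> Suc j" by simp
  note S = R[rule_format, OF this, unfolded diff_Suc_1]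
  show "prob_simplex N (p (Suc j))" using S by blast
  show "(\<exists>i<N. dphi phi_NH (max (x j i) 0) (t j) \<noteq> 0) \<longrightarrow>
           (\<exists>c>0. \<forall>i<N. p (Suc j) i = c * dphi phi_NH (max (x j i) 0) (t j))" using S by blast
  show "x (Suc j) i = x j i + inst_regret N (p (Suc j)) (l (Suc j)) i" if "i < N" using S that by blast
  show "t j \<le> t (Suc j)" using S by blast
  show "Phi phi_NH N (\<lambda>i. max (x (Suc j) i) 0) (t (Suc j)) = Phi phi_NH N (\<lambda>i. max (x j i) 0) (t j)"
    using S by blast
  show "V (Suc j) = V j + (\<Sum>i<N. (ddphi phi_NH (max (x j i) 0) (t j)
                     / (\<Sum>k<N. ddphi phi_NH (max (x j k) 0) (t j)))
                   * (inst_regret N (p (Suc j)) (l (Suc j)) i)\<^sup>2)"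
    using S by blast
qed

lemma t_mono: "i \<le> j \<Longrightarrow> t i \<le> t j"
  using t_le_Suc by (rule lift_Suc_mono_le[of t])

lemma t_ge: "t0 \<le> t j"
  using t_mono[of 0 j] init by simp

lemma t_pos: "0 < t j"
  using t_ge[of j] t0_ge by simp

lemma y_nonneg: "0 \<le> y j i"
  using t_pos[of j] by (simp add: y_def)

lemma w_pos: "0 < w j i"
  by (simp add: w_def)

lemma y_sq: "(y j i)\<^sup>2 = (max (x j i) 0)\<^sup>2 / t j"
  using t_pos[of j] by (simp add: y_def power_divide)

lemma al_sq: "(al j i)\<^sup>2 = (inst_regret N (p (Suc j)) (l (Suc j)) i)\<^sup>2 / t j"
  using t_pos[of j] by (simp add: al_def power_divide)

lemma phi_w: "phi_NH (max (x j i) 0) (t j) = w j i / sqrt (t j)"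
  using t_pos[of j] by (simp add: phi_NH_eq w_def y_sq)

text \<open>The potential is conserved and starts at \<open>N / sqrt t0\<close>; multiplying by
  \<open>sqrt (t j)\<close> gives the total weight.\<close>

lemma sum_w: "(\<Sum>i<N. w j i) = real N * sqrt (t j / t0)"
proof -
  have "Phi phi_NH N (\<lambda>i. max (x j i) 0) (t j) = real N / sqrt t0"
  proof (induction j)
    case 0
    have "Phi phi_NH N (\<lambda>i. max (x 0 i) 0) (t 0) = (\<Sum>i<N. 1 / sqrt t0)"
      unfolding Phi_def using t0_ge init by (intro sum.cong) (auto simp: phi_NH_eq)
    then show ?case by simp
  qed (simp add: Phi_Suc)
  then have "(\<Sum>i<N. w j i) / sqrt (t j) = real N / sqrt t0"
    by (simp add: Phi_def phi_w sum_divide_distrib)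
  then show ?thesis using t_pos[of j] t0_ge by (simp add: real_sqrt_divide field_simps)
qed

lemma dphi_w: "dphi phi_NH (max (x j i) 0) (t j) = (w j i * y j i) / t j"
  using t_pos[of j] by (simp add: dphi_NH phi_w y_def mult_ac)

lemma ddphi_w: "ddphi phi_NH (max (x j i) 0) (t j) = (w j i * (1 + (y j i)\<^sup>2)) / (t j * sqrt (t j))"
proof -
  have "1 / t j + (max (x j i) 0)\<^sup>2 / (t j)\<^sup>2 = (1 + (y j i)\<^sup>2) / t j"
    unfolding y_sq add_divide_distrib divide_divide_eq_left power2_eq_square[of "t j"] ..
  then show ?thesis using t_pos[of j] by (simp add: ddphi_NH phi_w mult_ac)
qed

lemma orth: "(\<Sum>i<N. w j i * y j i * al j i) = 0"
proof -
  have "(\<Sum>i<N. dphi phi_NH (max (x j i) 0) (t j) * inst_regret N (p (Suc j)) (l (Suc j)) i) = 0"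
    by (rule sum_gradient_inst_regret[OF simplex play])
  then have "(\<Sum>i<N. dphi phi_NH (max (x j i) 0) (t j) * inst_regret N (p (Suc j)) (l (Suc j)) i)
      * (t j / sqrt (t j)) = 0" by simp
  then show ?thesis using t_pos[of j] unfolding sum_distrib_right
    by (simp add: dphi_w al_def)
qed

text \<open>Proportionality of play and gradient, cross-multiplied: this form also covers rounds in
  which all derivatives vanish and the play is arbitrary.\<close>

lemma balance:
  assumes "i < N" "k < N"
  shows "w j i * y j i * p (Suc j) k = w j k * y j k * p (Suc j) i"
proof (cases "\<exists>i<N. dphi phi_NH (max (x j i) 0) (t j) \<noteq> 0")
  case True
  then obtain c where "\<forall>i<N. p (Suc j) i = c * dphi phi_NH (max (x j i) 0) (t j)" using play by blast
  then have P: "p (Suc j) i = c / t j * (w j i * y j i)" if "i < N" for i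
    using that by (simp add: dphi_w)
  show ?thesis unfolding P[OF assms(1)] P[OF assms(2)] by (simp only: mult_ac)
next
  case False
  then have "w j i * y j i = 0" "w j k * y j k = 0"
    using assms t_pos[of j] unfolding dphi_w by (metis divide_eq_0_iff less_irrefl)+
  then show ?thesis by (simp only: mult_zero_left)
qed

lemma Q_pos: "0 < Q j"
  unfolding Q_def using N2 w_pos by (intro sum_pos) (auto simp: lessThan_empty_iff add_pos_nonneg)

lemma A_nonneg: "0 \<le> A j"
  unfolding A_def using w_pos by (intro sum_nonneg) (simp add: less_imp_le)

lemma V_Suc': "V (Suc j) - V j = t j * (A j / Q j)"
proof -
  define r where "r = t j * sqrt (t j)"
  have r: "r > 0" using t_pos[of j] by (simp add: r_def)
  have S: "(\<Sum>k<N. ddphi phi_NH (max (x j k) 0) (t j)) = Q j / r"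
    by (simp add: ddphi_w Q_def r_def sum_divide_distrib)
  have "V (Suc j) - V j = (\<Sum>i<N. (w j i * (1 + (y j i)\<^sup>2)) / r / (Q j / r) * (t j * (al j i)\<^sup>2))"
    unfolding V_Suc S using t_pos[of j] by (simp add: ddphi_w r_def al_sq)
  also have "\<dots> = (\<Sum>i<N. t j / Q j * (w j i * (1 + (y j i)\<^sup>2) * (al j i)\<^sup>2))"
    using r by (intro sum.cong) auto
  also have "\<dots> = t j / Q j * A j" by (simp add: A_def sum_distrib_left)
  finally show ?thesis by simp
qed

lemma V_mono_Suc: "V j \<le> V (Suc j)"
  using V_Suc'[of j] t_pos[of j] A_nonneg[of j] Q_pos[of j]
  by (smt (verit) divide_nonneg_pos mult_nonneg_nonneg)

lemma V_nonneg: "0 \<le> V j"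
  using V_mono_Suc init(3) by (induction j) (auto intro: order_trans)

text \<open>The potential decreases strictly in time. Had the clock passed
  \<open>t j * (1 + v)\<close>, the conserved potential would lie strictly below its previous
  value.\<close>

lemma time_step:
  assumes v: "0 \<le> v"
    and dec: "(\<Sum>i<N. exp ((y j i + al j i)\<^sup>2 / (2 * (1 + v)))) \<le> sqrt (1 + v) * (\<Sum>i<N. w j i)"
  shows "t (Suc j) \<le> t j * (1 + v)"
proof (rule ccontr)
  assume neg: "\<not> ?thesis"
  define s where "s = t j * (1 + v)"
  define a where "a i = inst_regret N (p (Suc j)) (l (Suc j)) i" for i
  have s: "0 < s" using t_pos[of j] v by (simp add: s_def)
  have sq: "sqrt s = sqrt (t j) * sqrt (1 + v)" by (simp add: s_def real_sqrt_mult)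
  have "Phi phi_NH N (\<lambda>i. max (x (Suc j) i) 0) (t (Suc j)) < Phi phi_NH N (\<lambda>i. max (x (Suc j) i) 0) s"
    using neg s N2 by (intro Phi_NH_strict_antimono) (auto simp: s_def)
  \<comment> \<open>Stepping from the projected point and leaving out the second projection gives a
    coordinate of at least the same absolute value.\<close>
  also have "\<dots> \<le> Phi phi_NH N (\<lambda>i. max (x j i) 0 + a i) s"
    using s by (intro Phi_NH_mono_abs) (auto simp: x_Suc a_def)
  also have "\<dots> = (\<Sum>i<N. exp ((y j i + al j i)\<^sup>2 / (2 * (1 + v)))) / sqrt s"
  proof -
    have "(max (x j i) 0 + a i)\<^sup>2 / (2 * s) = (y j i + al j i)\<^sup>2 / (2 * (1 + v))" for i
    proof -
      have "(y j i + al j i)\<^sup>2 = (max (x j i) 0 + a i)\<^sup>2 / t j"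
        using t_pos[of j] by (simp add: y_def al_def a_def add_divide_distrib[symmetric] power_divide)
      then show ?thesis by (simp add: s_def mult_ac)
    qed
    then show ?thesis using s by (simp add: Phi_def phi_NH_eq sum_divide_distrib)
  qed
  also have "\<dots> \<le> (sqrt (1 + v) * (\<Sum>i<N. w j i)) / sqrt s"
    using dec s by (intro divide_right_mono) auto
  also have "\<dots> = (\<Sum>i<N. w j i) / sqrt (t j)" using v by (simp add: sq)
  also have "\<dots> = Phi phi_NH N (\<lambda>i. max (x j i) 0) (t j)"
    by (simp add: Phi_def phi_w sum_divide_distrib)
  finally show False by (simp add: Phi_Suc)
qed

lemma time_step_of_quadratic:
  assumes v: "v = (1 + d) * A j / Q j" "v \<le> 1/25" and d: "0 \<le> d" and c: "0 \<le> c" "c \<le> 1/4"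
    and small: "\<And>i. i < N \<Longrightarrow> y j i * al j i + (al j i)\<^sup>2 / 2 \<le> c"
    and quad: "(\<Sum>i<N. w j i * (al j i)\<^sup>2)
        + (1 + c/2) * (\<Sum>i<N. w j i * (y j i * al j i + ((al j i)\<^sup>2 - (y j i)\<^sup>2 * v) / 2)\<^sup>2)
      \<le> v * Q j + 37/50 * v\<^sup>2 * (\<Sum>i<N. w j i)"
  shows "t (Suc j) - t j \<le> (1 + d) * (V (Suc j) - V j)"
proof -
  have v0: "0 \<le> v" using v d A_nonneg[of j] Q_pos[of j] by simp
  have "t (Suc j) \<le> t j * (1 + v)"
    using exp_potential_decrease[OF v0 v(2) c small orth[of j, unfolded w_def] quad[unfolded w_def Q_def]]
    by (intro time_step[OF v0]) (simp only: w_def)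
  moreover have "t j * v = (1 + d) * (V (Suc j) - V j)" by (simp add: v V_Suc')
  ultimately show ?thesis by (simp add: distrib_left)
qed

section \<open>Numerical size of the increments\<close>

lemma exp1_sq_ge: "3780 \<le> 512 * (exp (1::real))\<^sup>2"
proof -
  \<comment> \<open>Seven Taylor terms give \<open>exp 1 \<ge> 1957/720\<close>, just accurate
    enough for \<open>3780\<close>.\<close>
  obtain s :: real where "exp 1 = (\<Sum>m<7. (1::real) ^ m / fact m) + exp s / fact 7 * 1 ^ 7"
    using Maclaurin_exp_le[of 1 7] by blast
  then have "exp 1 = 1957/720 + exp s / fact 7" by (simp add: eval_nat_numeral)
  then have "1957/720 \<le> exp (1::real)" by simp
  then have "(1957/720)\<^sup>2 \<le> (exp (1::real))\<^sup>2" by (intro power_mono) auto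
  then show ?thesis by (simp add: power2_eq_square)
qed

lemma ln_N_ge: "56/81 \<le> ln (real N)"
proof -
  \<comment> \<open>Two terms of the series for \<open>ln 2\<close> give
    \<open>2 * (1/3 + 1/81) = 56/81\<close>.\<close>
  have "56/81 \<le> ln (2::real)"
    using ln_approx_bounds[of 2 2] by (simp add: eval_nat_numeral)
  also have "\<dots> \<le> ln (real N)" using N2 by simp
  finally show ?thesis .
qed

lemma B_sq_ln: "3780 * (B\<^sup>2 * ln (real N)) \<le> t0"
proof -
  have "3780 * (B\<^sup>2 * ln (real N)) \<le> 512 * (exp 1)\<^sup>2 * (B\<^sup>2 * ln (real N))"
    using exp1_sq_ge ln_N_ge by (intro mult_right_mono) auto
  also have "\<dots> \<le> t0" using t0_ge(2) by (simp only: mult.assoc)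
  finally show ?thesis .
qed

lemma al_sq_le: "i < N \<Longrightarrow> (al j i)\<^sup>2 \<le> B\<^sup>2 / t j"
proof -
  assume i: "i < N"
  have "\<bar>inst_regret N (p (Suc j)) (l (Suc j)) i\<bar> \<le> B"
    using losses i by (intro abs_inst_regret_le[OF simplex]) auto
  then have "(inst_regret N (p (Suc j)) (l (Suc j)) i)\<^sup>2 \<le> B\<^sup>2"
    by (meson abs_ge_self abs_le_square_iff order_trans)
  then show ?thesis unfolding al_sq using t_pos[of j] by (intro divide_right_mono) auto
qed

lemma B_sq_le: "B\<^sup>2 / t j \<le> 1/2600"
proof -
  have "3780 * (B\<^sup>2 * (56/81)) \<le> 3780 * (B\<^sup>2 * ln (real N))"
    using ln_N_ge by (intro mult_left_mono) auto
  then have "2600 * B\<^sup>2 \<le> t j" using B_sq_ln t_ge[of j] zero_le_power2[of B] by linarith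
  then show ?thesis using t_pos[of j] by (simp add: field_simps)
qed

text \<open>One weight cannot exceed the total weight \<open>N * q\<close>, so
  \<open>y\<^sup>2 / 2 \<le> ln N + ln q\<close>. The growth in \<open>q\<close> is absorbed by
  \<open>t j = t0 * q\<^sup>2\<close>, and \<open>2 / 3780 = 1/1890\<close> remains.\<close>

lemma y_sq_B_sq_le:
  assumes i: "i < N"
  shows "(y j i)\<^sup>2 * (B\<^sup>2 / t j) \<le> 1/1890"
proof -
  define q where "q = sqrt (t j / t0)"
  have q1: "1 \<le> q" using t_ge[of j] t0_ge by (simp add: q_def)
  have q2: "t j = t0 * q\<^sup>2" using t_pos[of j] t0_ge by (simp add: q_def)
  have "w j i \<le> (\<Sum>i<N. w j i)"
    using i w_pos by (intro member_le_sum) (auto simp: less_imp_le)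
  also have "\<dots> = real N * q" by (simp add: sum_w q_def)
  finally have "ln (w j i) \<le> ln (real N * q)" using w_pos[of j i] by simp
  then have "(y j i)\<^sup>2 / 2 \<le> ln (real N) + ln q" using q1 N2 by (simp add: w_def ln_mult)
  \<comment> \<open>Uses \<open>ln N \<ge> 1/2\<close>, which holds for two or more experts.\<close>
  also have "ln q \<le> ln (real N) * (q\<^sup>2 - 1)"
  proof -
    have "ln q \<le> q - 1" using q1 by (intro ln_le_minus_one) auto
    also have "\<dots> = 1/2 * (2 * (q - 1))" by simp
    also have "\<dots> \<le> ln (real N) * (q\<^sup>2 - 1)"
    proof (intro mult_mono)
      show "2 * (q - 1) \<le> q\<^sup>2 - 1"
        using zero_le_power2[of "q - 1"] by (simp add: power2_eq_square algebra_simps)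
    qed (use ln_N_ge q1 in auto)
    finally show ?thesis .
  qed
  finally have y: "(y j i)\<^sup>2 \<le> 2 * (ln (real N) * q\<^sup>2)" by (simp add: algebra_simps)
  have "(y j i)\<^sup>2 * B\<^sup>2 \<le> 2 * (ln (real N) * q\<^sup>2) * B\<^sup>2" using y by (intro mult_right_mono) auto
  also have "\<dots> = (3780 * (B\<^sup>2 * ln (real N))) * (q\<^sup>2 / 1890)" by simp
  also have "\<dots> \<le> t0 * (q\<^sup>2 / 1890)" using B_sq_ln by (intro mult_right_mono) auto
  also have "\<dots> = t j / 1890" by (simp add: q2)
  finally show ?thesis using t_pos[of j] by (simp add: field_simps)
qed

lemma small_increment:
  assumes i: "i < N" and g: "(y j i)\<^sup>2 * (B\<^sup>2 / t j) \<le> r\<^sup>2" "0 \<le> r"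
  shows "y j i * al j i + (al j i)\<^sup>2 / 2 \<le> r + 1/5200"
proof -
  have "(y j i * al j i)\<^sup>2 \<le> (y j i)\<^sup>2 * (B\<^sup>2 / t j)"
    unfolding power_mult_distrib using al_sq_le[OF i] by (intro mult_left_mono) auto
  then have "y j i * al j i \<le> r" using g by (meson order_trans power2_le_imp_le)
  then show ?thesis using al_sq_le[OF i, of j] B_sq_le[of j] by linarith
qed

section \<open>Elapsed time against variance in one round\<close>

lemma time_step_general: "t (Suc j) - t j \<le> 21/20 * (V (Suc j) - V j)"
proof -
  define v where "v = (1 + 1/20) * A j / Q j"
  define b2 where "b2 = B\<^sup>2 / t j"
  have b2: "0 \<le> b2" "b2 \<le> 1/2600" using B_sq_le[of j] t_pos[of j] by (auto simp: b2_def)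
  \<comment> \<open>With \<open>\<sigma> = 1\<close> and Young weight \<open>1/50\<close>, the two
    errors are about \<open>0.032\<close> and \<open>0.013\<close>, together below
    \<open>1/20\<close>. The value \<open>3/125\<close> is the bound on the exponent increments,
    justified below by \<open>1/43 + 1/5200\<close>.\<close>
  have cond: "((1 + (3/125)/2) * (1 + 1/50) - 1) * 1
      + (1 + (3/125)/2) * ((1 + 1/(1/50)) / 4) * (b2 + (1 + 1/20)\<^sup>2 * (1/1890)) \<le> (1/20 :: real)"
  proof -
    have "b2 + (1 + 1/20)\<^sup>2 * (1/1890) \<le> 97/100000" using b2 by (simp add: power2_eq_square)
    then have "(1 + (3/125)/2) * ((1 + 1/(1/50)) / 4) * (b2 + (1 + 1/20)\<^sup>2 * (1/1890))
        \<le> (1 + (3/125)/2) * ((1 + 1/(1/50)) / 4) * (97/100000)" by (rule mult_left_mono) simp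
    then show ?thesis by (rule order_trans[OF add_left_mono]) simp
  qed
  note generic = quadratic_condition_generic[of N "w j" v "1/20" "y j" "al j" b2 "1/1890" 1 "(3/125)/2" "1/50"]
  have v_le: "v \<le> (1 + 1/20) * b2"
    by (rule generic(1))
      (use N2 w_pos al_sq_le y_sq_B_sq_le cond in \<open>auto simp: v_def A_def Q_def b2_def\<close>)
  have quad: "(\<Sum>i<N. w j i * (al j i)\<^sup>2)
        + (1 + (3/125)/2) * (\<Sum>i<N. w j i * (y j i * al j i + ((al j i)\<^sup>2 - (y j i)\<^sup>2 * v) / 2)\<^sup>2) \<le> v * Q j"
    unfolding Q_def by (rule generic(2))
      (use N2 w_pos al_sq_le y_sq_B_sq_le cond in \<open>auto simp: v_def A_def Q_def b2_def\<close>)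
  have "0 \<le> 37/50 * v\<^sup>2 * (\<Sum>i<N. w j i)" using w_pos by (simp add: sum_nonneg less_imp_le)
  then have "(\<Sum>i<N. w j i * (al j i)\<^sup>2)
        + (1 + (3/125)/2) * (\<Sum>i<N. w j i * (y j i * al j i + ((al j i)\<^sup>2 - (y j i)\<^sup>2 * v) / 2)\<^sup>2)
      \<le> v * Q j + 37/50 * v\<^sup>2 * (\<Sum>i<N. w j i)" using quad by linarith
  moreover have "y j i * al j i + (al j i)\<^sup>2 / 2 \<le> 3/125" if "i < N" for i
  proof -
    have "(y j i)\<^sup>2 * (B\<^sup>2 / t j) \<le> (1/43)\<^sup>2"
      using y_sq_B_sq_le[OF that, of j] by (simp add: power2_eq_square)
    from small_increment[OF that this] show ?thesis by simp
  qed
  moreover have "v \<le> 1/25" using v_le b2 by simp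
  ultimately have "t (Suc j) - t j \<le> (1 + 1/20) * (V (Suc j) - V j)"
    by (intro time_step_of_quadratic[of v _ _ "3/125"]) (auto simp: v_def)
  then show ?thesis by simp
qed

text \<open>The overhead \<open>S/4\<close> is dictated by the conserved potential: for two experts
  the total weight yields \<open>1 + S/4 \<le> sqrt (t j / t0)\<close>, the factor wanted in the
  summation.\<close>

lemma time_step_two:
  assumes two: "N = 2" and S: "S = (y j 0)\<^sup>2 + (y j 1)\<^sup>2" "S \<le> 1/5"
  shows "t (Suc j) - t j \<le> (1 + S/4) * (V (Suc j) - V j)"
proof -
  define v where "v = (1 + S/4) * A j / Q j"
  have sum2: "(\<Sum>i<N. f i) = f 0 + f 1" for f :: "nat \<Rightarrow> real" by (simp add: two numeral_2_eq_2)
  have S0: "0 \<le> S" by (simp add: S)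
  have yS: "(y j i)\<^sup>2 \<le> S" if "i < N" for i
  proof -
    have "i = 0 \<or> i = 1" using that two by auto
    then show ?thesis by (auto simp: S)
  qed
  have al: "(al j i)\<^sup>2 \<le> 1/2600" if "i < N" for i
    using al_sq_le[OF that, of j] B_sq_le[of j] by linarith
  have yB: "(y j i)\<^sup>2 * (B\<^sup>2 / t j) \<le> S * (1/2600)" if "i < N" for i
    using yS[OF that] B_sq_le[of j] S0 t_pos[of j] by (intro mult_mono) auto
  show ?thesis
  proof (cases "3/200 \<le> S")
    case True
    \<comment> \<open>Now \<open>\<sigma> = S\<close> makes the main error about
      \<open>0.106 * S\<close>, but a constant near \<open>0.0013\<close> is left over. It fits
      under \<open>S/4\<close> only when \<open>S\<close> is not too small, hence the threshold
      \<open>3/200\<close>.\<close>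
    have cond: "((1 + (1/100)/2) * (1 + 1/10) - 1) * S
      + (1 + (1/100)/2) * ((1 + 1/(1/10)) / 4) * (1/2600 + (1 + S/4)\<^sup>2 * (1/13000)) \<le> S/4"
    proof -
      have "(1 + S/4)\<^sup>2 \<le> (1 + (1/5)/4)\<^sup>2" using S S0 by (intro power_mono) auto
      also have "\<dots> \<le> 6/5" by (simp add: power2_eq_square)
      finally have "1/2600 + (1 + S/4)\<^sup>2 * (1/13000) \<le> 48/100000" by simp
      then have "(1 + (1/100)/2) * ((1 + 1/(1/10)) / 4) * (1/2600 + (1 + S/4)\<^sup>2 * (1/13000))
          \<le> (1 + (1/100)/2) * ((1 + 1/(1/10)) / 4) * (48/100000)" by (rule mult_left_mono) simp
      then show ?thesis by (rule order_trans[OF add_left_mono]) (use True in simp)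
    qed
    note generic = quadratic_condition_generic[of N "w j" v "S/4" "y j" "al j" "1/2600" "1/13000" S "(1/100)/2" "1/10"]
    have g2: "(y j i)\<^sup>2 * (1/2600) \<le> 1/13000" if "i < N" for i
      using yS[OF that] S by simp
    have \<sigma>: "(y j i)\<^sup>2 \<le> S * (1 + (y j i)\<^sup>2)" if "i < N" for i
      using yS[OF that] S0 by (simp add: distrib_left add_increasing2)
    have v_le: "v \<le> (1 + S/4) * (1/2600)"
      by (rule generic(1)) (use N2 w_pos al g2 \<sigma> cond S0 in \<open>auto simp: v_def A_def Q_def\<close>)
    have quad: "(\<Sum>i<N. w j i * (al j i)\<^sup>2)
        + (1 + (1/100)/2) * (\<Sum>i<N. w j i * (y j i * al j i + ((al j i)\<^sup>2 - (y j i)\<^sup>2 * v) / 2)\<^sup>2) \<le> v * Q j"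
      unfolding Q_def by (rule generic(2))
        (use N2 w_pos al g2 \<sigma> cond S0 in \<open>auto simp: v_def A_def Q_def\<close>)
    have "0 \<le> 37/50 * v\<^sup>2 * (\<Sum>i<N. w j i)" using w_pos by (simp add: sum_nonneg less_imp_le)
    then have "(\<Sum>i<N. w j i * (al j i)\<^sup>2)
        + (1 + (1/100)/2) * (\<Sum>i<N. w j i * (y j i * al j i + ((al j i)\<^sup>2 - (y j i)\<^sup>2 * v) / 2)\<^sup>2)
      \<le> v * Q j + 37/50 * v\<^sup>2 * (\<Sum>i<N. w j i)" using quad by linarith
    moreover have "y j i * al j i + (al j i)\<^sup>2 / 2 \<le> 1/100" if "i < N" for i
    proof -
      have "(y j i)\<^sup>2 * (B\<^sup>2 / t j) \<le> (9/1000)\<^sup>2"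
        using yB[OF that] S by (simp add: power2_eq_square)
      from small_increment[OF that this] show ?thesis by simp
    qed
    moreover have "v \<le> 1/25" using v_le S(2) by argo
    ultimately show ?thesis
      using S0 by (intro time_step_of_quadratic[of v _ _ "1/100"]) (auto simp: v_def)
  next
    case False
    define p1 where "p1 = p (Suc j) 0"
    define p2 where "p2 = p (Suc j) 1"
    \<comment> \<open>Below the threshold the two-expert estimate applies: the increments are
      \<open>p2 * b\<close> and \<open>- p1 * b\<close>, with \<open>b\<close> the scaled loss
      difference.\<close>
    define b where "b = (l (Suc j) 1 - l (Suc j) 0) / sqrt (t j)"
    have p: "0 \<le> p1" "0 \<le> p2" "p1 + p2 = 1"
      using simplex[of j] unfolding prob_simplex_def sum2 p1_def p2_def by (auto simp: two)
    have "al j 0 = (p1 * l (Suc j) 0 + p2 * l (Suc j) 1 - (p1 + p2) * l (Suc j) 0) / sqrt (t j)"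
      unfolding p(3) unfolding al_def inst_regret_def sum2 p1_def p2_def by simp
    then have al0: "al j 0 = p2 * b" by (simp add: b_def algebra_simps)
    have "al j 1 = (p1 * l (Suc j) 0 + p2 * l (Suc j) 1 - (p1 + p2) * l (Suc j) 1) / sqrt (t j)"
      unfolding p(3) unfolding al_def inst_regret_def sum2 p1_def p2_def by simp
    then have al1: "al j 1 = - p1 * b" by (simp add: b_def algebra_simps diff_divide_distrib)
    have b2: "b\<^sup>2 \<le> 1/2600"
    proof -
      have "\<bar>l (Suc j) 1 - l (Suc j) 0\<bar> \<le> \<bar>B\<bar>"
        using losses[of "Suc j" 1 0] two by simp
      then have "(l (Suc j) 1 - l (Suc j) 0)\<^sup>2 \<le> B\<^sup>2" by (simp add: abs_le_square_iff)
      then have "b\<^sup>2 \<le> B\<^sup>2 / t j" using t_pos[of j] by (simp add: b_def power_divide divide_right_mono)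
      then show ?thesis using B_sq_le[of j] by linarith
    qed
    have bal: "w j 0 * y j 0 * p2 = w j 1 * y j 1 * p1"
      using balance[of 0 1 j] two by (simp add: p1_def p2_def)
    have A2: "A j = w j 0 * (1 + (y j 0)\<^sup>2) * (p2 * b)\<^sup>2 + w j 1 * (1 + (y j 1)\<^sup>2) * (p1 * b)\<^sup>2"
      unfolding A_def sum2 al0 al1 by simp
    have Q2: "Q j = w j 0 * (1 + (y j 0)\<^sup>2) + w j 1 * (1 + (y j 1)\<^sup>2)"
      unfolding Q_def sum2 ..
    have quad: "w j 0 * (p2 * b)\<^sup>2 + w j 1 * (p1 * b)\<^sup>2
      + (1 + 1/500) * (w j 0 * (y j 0 * (p2 * b) + ((p2 * b)\<^sup>2 - (y j 0)\<^sup>2 * v) / 2)\<^sup>2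
                     + w j 1 * (y j 1 * (- p1 * b) + ((p1 * b)\<^sup>2 - (y j 1)\<^sup>2 * v) / 2)\<^sup>2)
      \<le> v * Q j + 37/50 * v\<^sup>2 * (w j 0 + w j 1)"
      unfolding Q2 w_def
      by (rule two_expert_quadratic_condition)
        (use False S y_nonneg p bal b2 in \<open>auto simp: w_def v_def A2 Q2\<close>)
    have "(\<Sum>i<N. w j i * (al j i)\<^sup>2)
        + (1 + (1/250)/2) * (\<Sum>i<N. w j i * (y j i * al j i + ((al j i)\<^sup>2 - (y j i)\<^sup>2 * v) / 2)\<^sup>2)
      \<le> v * Q j + 37/50 * v\<^sup>2 * (\<Sum>i<N. w j i)"
      using quad unfolding sum2 al0 al1 by simp
    moreover have "y j i * al j i + (al j i)\<^sup>2 / 2 \<le> 1/250" if "i < N" for i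
    proof -
      have "(y j i)\<^sup>2 * (B\<^sup>2 / t j) \<le> (3/1000)\<^sup>2"
        using yB[OF that] False by (simp add: power2_eq_square)
      from small_increment[OF that this] show ?thesis by simp
    qed
    moreover have "v \<le> 1/25"
    proof -
      have "A j \<le> (\<Sum>i<N. w j i * (1 + (y j i)\<^sup>2) * (1/2600))"
        unfolding A_def using al w_pos by (intro sum_mono mult_left_mono) (auto simp: less_imp_le)
      also have "\<dots> = Q j * (1/2600)" by (simp add: Q_def sum_distrib_right)
      finally have "A j / Q j \<le> 1/2600" using Q_pos[of j] by (simp add: field_simps)
      then have "(1 + S/4) * (A j / Q j) \<le> 2 * (1/2600)"
        using S S0 A_nonneg[of j] Q_pos[of j] by (intro mult_mono) auto
      moreover have "v = (1 + S/4) * (A j / Q j)" by (simp add: v_def)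
      ultimately show ?thesis by linarith
    qed
    ultimately show ?thesis
      using S0 by (intro time_step_of_quadratic[of v _ _ "1/250"]) (auto simp: v_def)
  qed
qed

section \<open>Summation over the rounds\<close>

lemma time_le: "t j - t0 \<le> 21/20 * V j"
proof (induction j)
  case 0
  then show ?case by (simp add: init)
next
  case (Suc j)
  then show ?case using time_step_general[of j] by argo
qed

text \<open>The factor is fixed at the final time \<open>T\<close>, so that it dominates the
  overhead of every earlier round.\<close>

lemma time_le_two:
  assumes two: "N = 2" and q: "sqrt (t T / t0) \<le> 21/20"
  shows "j \<le> T \<Longrightarrow> t j - t0 \<le> sqrt (t T / t0) * V j"
proof (induction j)
  case 0
  then show ?case by (simp add: init)
next
  case (Suc j)
  define q where "q = sqrt (t T / t0)"
  define S where "S = (y j 0)\<^sup>2 + (y j 1)\<^sup>2"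
  have "w j 0 + w j 1 = 2 * sqrt (t j / t0)"
    using sum_w[of j] two by (simp add: numeral_2_eq_2)
  \<comment> \<open>Expanding the weights to first order below their known total
    \<open>2 * sqrt (t j / t0)\<close> bounds \<open>S\<close>.\<close>
  moreover have "1 + (y j i)\<^sup>2 / 2 \<le> w j i" for i unfolding w_def by (rule exp_ge_add_one_self)
  then have "2 + S / 2 \<le> w j 0 + w j 1"
    using add_mono[of "1 + (y j 0)\<^sup>2 / 2" "w j 0" "1 + (y j 1)\<^sup>2 / 2" "w j 1"] by (simp add: S_def add_divide_distrib)
  moreover have "sqrt (t j / t0) \<le> q"
    unfolding q_def using t_mono[of j T] Suc.prems t0_ge by (intro real_sqrt_le_mono divide_right_mono) auto
  ultimately have Sq: "1 + S/4 \<le> q" by linarith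
  moreover have "q \<le> 21/20" using assms by (simp add: q_def)
  ultimately have "S \<le> 1/5" by linarith
  then have "t (Suc j) - t j \<le> (1 + S/4) * (V (Suc j) - V j)"
    by (rule time_step_two[OF two S_def])
  also have "\<dots> \<le> q * (V (Suc j) - V j)" using Sq V_mono_Suc[of j] by (intro mult_right_mono) auto
  finally have "t (Suc j) - t j \<le> q * V (Suc j) - q * V j" by (simp add: right_diff_distrib)
  moreover have "t j - t0 \<le> q * V j" using Suc by (simp add: q_def)
  ultimately show ?case unfolding q_def[symmetric] by linarith
qed

lemma potential_ge:
  assumes X: "0 < X" and k: "k \<le> card {i. i < N \<and> X \<le> x j i}"
  shows "real k * exp (X\<^sup>2 / (2 * t j)) + (real N - real k) \<le> real N * sqrt (t j / t0)"
proof -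
  define C where "C = {i. i < N \<and> X \<le> x j i}"
  define E where "E = exp (X\<^sup>2 / (2 * t j))"
  have E1: "1 \<le> E" using t_pos[of j] by (simp add: E_def)
  have CN: "C \<subseteq> {..<N}" "finite C" by (auto simp: C_def)
  have "E \<le> w j i" if "i \<in> C" for i
  proof -
    have "X\<^sup>2 \<le> (max (x j i) 0)\<^sup>2" using that X by (intro power_mono) (auto simp: C_def)
    then have "X\<^sup>2 / t j \<le> (y j i)\<^sup>2" unfolding y_sq using t_pos[of j] by (intro divide_right_mono) auto
    then show ?thesis by (simp add: E_def w_def)
  qed
  then have 1: "(\<Sum>i\<in>C. E) \<le> (\<Sum>i\<in>C. w j i)" by (intro sum_mono) auto
  have 2: "(\<Sum>i\<in>{..<N} - C. 1) \<le> (\<Sum>i\<in>{..<N} - C. w j i)"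
    by (intro sum_mono) (simp add: w_def)
  have "card ({..<N} - C) = N - card C" "card C \<le> N"
    using CN card_mono[OF _ CN(1)] by (auto simp: card_Diff_subset)
  then have "real (card C) * E + (real N - real (card C)) \<le> (\<Sum>i\<in>C. w j i) + (\<Sum>i\<in>{..<N} - C. w j i)"
    using 1 2 by (simp add: of_nat_diff)
  also have "\<dots> = (\<Sum>i<N. w j i)" using CN by (metis add.commute finite_lessThan sum.subset_diff)
  also have "\<dots> = real N * sqrt (t j / t0)" by (rule sum_w)
  finally have "real (card C) * (E - 1) + real N \<le> real N * sqrt (t j / t0)" by (simp add: algebra_simps)
  \<comment> \<open>Having more than \<open>k\<close> coordinates above \<open>X\<close> only
    strengthens the bound, as \<open>E \<ge> 1\<close>.\<close>
  moreover have "real k * (E - 1) \<le> real (card C) * (E - 1)"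
    using k E1 by (intro mult_right_mono) (auto simp: C_def)
  ultimately show ?thesis unfolding E_def[symmetric] by (simp add: algebra_simps)
qed

lemma regret_le:
  assumes eps: "0 < eps" "eps < 1"
  shows "regret_eps N eps (x T) \<le> sqrt ((t0 + 2 * V T) * (ln (t0 + 2 * V T) + 2 * ln (1 / eps)))"
proof -
  define k where "k = max 1 (nat \<lfloor>real N * eps\<rfloor>)"
  define X where "X = kth_largest N k (x T)"
  have "real N * eps < real N" using eps N2 by simp
  then have "\<lfloor>real N * eps\<rfloor> < int N" by (simp add: floor_less_iff)
  then have k: "1 \<le> k" "k < N" using N2 by (auto simp: k_def)
  \<comment> \<open>Rounding down loses less than one; the maximum with \<open>1\<close> only
    increases \<open>k\<close>.\<close>
  have "real N * eps < real_of_int \<lfloor>real N * eps\<rfloor> + 1" by linarith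
  also have "real_of_int \<lfloor>real N * eps\<rfloor> \<le> real k"
  proof -
    have "nat \<lfloor>real N * eps\<rfloor> \<le> k" by (simp add: k_def)
    then have "\<lfloor>real N * eps\<rfloor> \<le> int k" by linarith
    then show ?thesis by linarith
  qed
  finally have keps: "eps \<le> (real k + 1) / real N" using N2 by (simp add: field_simps)
  have "X \<le> sqrt ((t0 + 2 * V T) * (ln (t0 + 2 * V T) + 2 * ln (1 / eps)))"
  proof (cases "0 < X")
    case True
    have "k \<le> card {i. i < N \<and> X \<le> x T i}"
      unfolding X_def using k by (intro card_ge_kth_largest) auto
    then show ?thesis
      using regret_bound_of_time[OF k eps(1) keps t0_ge(1) t_ge potential_ge[OF True] time_le]
        time_le_two[of T T] by blast
  next
    case False
    \<comment> \<open>For \<open>X \<le> 0\<close> it suffices that the right side is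
      nonnegative.\<close>
    have "1 \<le> t0 + 2 * V T" using t0_ge V_nonneg[of T] by simp
    moreover have "0 \<le> ln (1 / eps)" using eps by simp
    ultimately have "0 \<le> sqrt ((t0 + 2 * V T) * (ln (t0 + 2 * V T) + 2 * ln (1 / eps)))" by simp
    then show ?thesis using False by linarith
  qed
  then show ?thesis by (simp add: regret_eps_def X_def k_def)
qed

end

lemma regret_single_expert:
  assumes run: "cp_run phi_NH {0..} 1 t0 l p x t V" and "1 \<le> t0" "0 < eps" "eps < 1"
  shows "regret_eps 1 eps (x T) \<le> sqrt ((t0 + 2 * V T) * (ln (t0 + 2 * V T) + 2 * ln (1 / eps)))"
proof -
  have "x j 0 = 0 \<and> V j = 0" for j
  proof (induction j)
    case 0
    then show ?case using run by (simp add: cp_run_def)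
  next
    case (Suc j)
    have "prob_simplex 1 (p (Suc j))" using run by (simp add: cp_run_def)
    then have "inst_regret 1 (p (Suc j)) (l (Suc j)) 0 = 0"
      by (simp add: prob_simplex_def inst_regret_def)
    then show ?case using run Suc by (simp add: cp_run_def)
  qed
  \<comment> \<open>The quantile index is rounded to \<open>0\<close> here, so the convention
    \<open>k = 1\<close> selects the only coordinate, which is zero.\<close>
  moreover have "\<lfloor>eps\<rfloor> = 0" using assms by (simp add: floor_eq_iff)
  ultimately show ?thesis using assms by (simp add: regret_eps_def kth_largest_def)
qed

theorem theorem4p2:
  fixes N :: nat and B :: real and l :: "nat \<Rightarrow> nat \<Rightarrow> real"
  assumes "N \<ge> 1" and "B > 0"
    and "\<forall>j\<ge>1. \<forall>i<N. \<forall>i'<N. \<bar>l j i - l j i'\<bar> \<le> B"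
  defines "t0 \<equiv> max (512 * (exp 1)\<^sup>2 * B\<^sup>2 * ln (real N)) 1"
  shows "(\<exists>p x t V. cp_run phi_NH {0..} N t0 l p x t V) \<and>
         (\<forall>p x t V. cp_run phi_NH {0..} N t0 l p x t V \<longrightarrow>
            (\<forall>eps T. 0 < eps \<and> eps < 1 \<and> T \<ge> 1 \<longrightarrow>
               regret_eps N eps (x T)
                 \<le> sqrt ((t0 + 2 * V T) * (ln (t0 + 2 * V T) + 2 * ln (1 / eps)))))"
proof (intro conjI allI impI)
  have t0: "1 \<le> t0" "512 * (exp 1)\<^sup>2 * B\<^sup>2 * ln (real N) \<le> t0" by (simp_all add: t0_def)
  show "\<exists>p x t V. cp_run phi_NH {0..} N t0 l p x t V"
    using cp_run_NH_exists[OF assms(1), of t0 l] t0 by simp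
  fix p x t V and eps :: real and T :: nat
  assume run: "cp_run phi_NH {0..} N t0 l p x t V" and eps: "0 < eps \<and> eps < 1 \<and> T \<ge> 1"
  show "regret_eps N eps (x T) \<le> sqrt ((t0 + 2 * V T) * (ln (t0 + 2 * V T) + 2 * ln (1 / eps)))"
  proof (cases "N = 1")
    case True
    then show ?thesis using regret_single_expert run t0 eps by blast
  next
    case False
    then have "N \<ge> 2" using assms(1) by simp
    then interpret NH_run N B t0 l p x t V
      using run t0 assms(3) by unfold_locales auto
    show ?thesis using regret_le eps by blast
  qed
qed

end
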